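(* Suppose that: (i) $c(x,x')=(x-x')^TA(x)(x-x')$ is lower semicontinuous and there are positive constants $\rho_{\min},\rho_{\max}$ with $\rho_{\min}\le v^TA(x)v\le\rho_{\max}$ for all unit vectors $v$ and $P_0$-almost every $x\in\mathbb{R}^d$; (ii) $\ell:\mathbb{R}\to\mathbb{R}$ is convex, $\kappa:=\inf\{s\ge0:\sup_{u\in\mathbb{R}}(\ell(u)-su^2)<\infty\}$ is finite, and $E_{P_0}\|X\|^4<\infty$; (iii) $\ell$ is twice differentiable with $\ell''(\cdot)\le M$ for a positive constant $M$, and for every $\beta\in B$ the random variable $\ell'(\beta^TX)$ is not identically $0$ (i.e. $P_0(\ell'(\beta^TX)\neq0)>0$); (iv) $B\subseteq\mathbb{R}^d$ is convex and compact, with $R_\beta:=\sup_{\beta\in B}\|\beta\|<\infty$. Then there exist positive constants $\delta_0,\kappa_0$ (not depending on $\delta$) such that, whenever $\delta<\delta_0$, the function $f_\delta:B\times\mathbb{R}_+\to\mathbb{R}\cup\{\infty\}$ satisfies: (a) $f_\delta$ is twice differentiable throughout $\mathbb{V}$ with a uniformly bounded Hessian; (b) $\dfrac{\partial^2f_\delta}{\partial\beta^2}(\beta,\lambda)\succeq\sqrt\delta\,\kappa_0\,\lambda^{-1}\,\mathbb{I}_d$ for $(\beta,\lambda)\in\mathbb{V}$.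
   Context: Let $d\ge1$, $B\subseteq\mathbb{R}^d$ nonempty, $\delta>0$, $P_0$ a Borel probability measure on $\mathbb{R}^d$, $\ell:\mathbb{R}\to\mathbb{R}$, and $A:\mathbb{R}^d\to\mathbb{S}_d^{++}$ (real symmetric positive definite $d\times d$ matrices). $E_{P_0}$ denotes expectation with $X\sim P_0$, $\mathbb{R}_+=[0,\infty)$, $\|\cdot\|$ is the Euclidean norm, $\mathbb{I}_d$ the identity matrix, and $\succeq$ the positive semidefinite order. Define $$F(\gamma,\beta,\lambda;x)=\ell\big(\beta^Tx+\gamma\sqrt\delta\,\beta^TA(x)^{-1}\beta\big)-\lambda\sqrt\delta\,\big(\gamma^2\beta^TA(x)^{-1}\beta-1\big),$$ $\ell_{rob}(\beta,\lambda;x)=\sup_{\gamma\in\mathbb{R}}F(\gamma,\beta,\lambda;x)$ and $f_\delta(\beta,\lambda)=E_{P_0}[\ell_{rob}(\beta,\lambda;X)]$; these formulas make sense for all $\beta\in\mathbb{R}^d$, which is how derivatives at boundary points of $B$ are understood. Let $$\mathbb{V}=\{(\beta,\lambda)\in B\times\mathbb{R}_+:K_1\|\beta\|\le\lambda\le K_2\|\beta\|\},\quad K_1=\tfrac12\sqrt{\underline L\,\rho_{\max}^{-1}},\quad K_2=\tfrac12\sqrt\delta\,MR_\beta\rho_{\min}^{-1}+\sqrt{\rho_{\min}^{-1}\overline L},$$ where $\underline L,\overline L>0$ are constants (which exist under the hypotheses, and do not depend on $\delta$) with $\underline L\le E_{P_0}[\ell'(\beta^TX)^2]\le\overline L$ for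 every $\beta\in B$.
   Formalization: If 0 ∈ B, then (0,0) ∈ 𝕍, where f_δ is not differentiable and λ⁻¹ is undefined, and the Hessian can blow up nearby; so (a) and (b) are stated on 𝕍 without (0,0), with the Hessian bounded on 𝕍 if 0 ∉ B and otherwise on the part of 𝕍 with ‖β‖ ≥ ε, for each ε > 0. *)

theory Defs
  imports "HOL-Probability.Probability"
begin

definition positive_definite :: "real^'n^'n \<Rightarrow> bool" where
  "positive_definite S \<longleftrightarrow> transpose S = S \<and> (\<forall>v. v \<noteq> 0 \<longrightarrow> 0 < v \<bullet> (S *v v))"

definition positive_semidefinite :: "real^'n^'n \<Rightarrow> bool" where
  "positive_semidefinite S \<longleftrightarrow> transpose S = S \<and> (\<forall>v. 0 \<le> v \<bullet> (S *v v))"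

definition loewner_ge :: "real^'n^'n \<Rightarrow> real^'n^'n \<Rightarrow> bool" where
  "loewner_ge S T \<longleftrightarrow> positive_semidefinite (S - T)"

definition lower_semicontinuous :: "('a::topological_space \<Rightarrow> real) \<Rightarrow> bool" where
  "lower_semicontinuous g \<longleftrightarrow> (\<forall>z a. a < g z \<longrightarrow> (\<forall>\<^sub>F w in nhds z. a < g w))"

text \<open>Expectation of an extended-real random variable as \<open>E[Y\<^sup>+] - E[Y\<^sup>-]\<close>, meaningful
  whenever the negative part is integrable.\<close>

definition ext_expectation :: "'a measure \<Rightarrow> ('a \<Rightarrow> ereal) \<Rightarrow> ereal" where
  "ext_expectation P Y =
     enn2ereal (\<integral>\<^sup>+x. e2ennreal (Y x) \<partial>P) - enn2ereal (\<integral>\<^sup>+x. e2ennreal (- Y x) \<partial>P)"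

text \<open>Second-order differentiability of an extended-real function at \<open>z\<close>: the function is finite
  and differentiable on a neighbourhood of \<open>z\<close>, with a gradient field that is (Frechet)
  differentiable at \<open>z\<close>. The Hessian is the derivative of the gradient, as a linear map.\<close>

definition has_hessian ::
  "('a::euclidean_space \<Rightarrow> ereal) \<Rightarrow> ('a \<Rightarrow> 'a) \<Rightarrow> 'a \<Rightarrow> bool" where
  "has_hessian f H z \<longleftrightarrow>
     (\<exists>g. (\<forall>\<^sub>F y in nhds z. \<bar>f y\<bar> \<noteq> \<infinity> \<and>
             ((\<lambda>w. real_of_ereal (f w)) has_derivative (\<lambda>h. g y \<bullet> h)) (at y)) \<and>
          (g has_derivative H) (at z))"

definition twice_differentiable_at :: "('a::euclidean_space \<Rightarrow> ereal) \<Rightarrow> 'a \<Rightarrow> bool" where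
  "twice_differentiable_at f z \<longleftrightarrow> (\<exists>H. has_hessian f H z)"

definition hessian :: "('a::euclidean_space \<Rightarrow> ereal) \<Rightarrow> 'a \<Rightarrow> 'a \<Rightarrow> 'a" where
  "hessian f z = (THE H. has_hessian f H z)"

lemma has_hessian_unique:
  assumes "has_hessian f H z" "has_hessian f H' z"
  shows "H = H'"
proof -
  obtain g where
    g: "\<forall>\<^sub>F y in nhds z. ((\<lambda>w. real_of_ereal (f w)) has_derivative (\<lambda>h. g y \<bullet> h)) (at y)"
       "(g has_derivative H) (at z)"
    using assms(1) unfolding has_hessian_def by (auto simp: eventually_conj_iff)
  obtain g' where
    g': "\<forall>\<^sub>F y in nhds z. ((\<lambda>w. real_of_ereal (f w)) has_derivative (\<lambda>h. g' y \<bullet> h)) (at y)"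
        "(g' has_derivative H') (at z)"
    using assms(2) unfolding has_hessian_def by (auto simp: eventually_conj_iff)
  have ev: "\<forall>\<^sub>F y in nhds z. g y = g' y"
    using g(1) g'(1)
  proof eventually_elim
    case (elim y)
    have "(\<lambda>h. g y \<bullet> h) = (\<lambda>h. g' y \<bullet> h)"
      by (rule has_derivative_unique[OF elim(1) elim(2)])
    then have "\<forall>h. g y \<bullet> h = g' y \<bullet> h"
      by metis
    then show ?case
      using vector_eq_rdot[of "g y" "g' y"] by (simp add: inner_commute)
  qed
  have "(g' has_derivative H) (at z)"
  proof (rule has_derivative_transform_eventually[OF g(2)])
    show "\<forall>\<^sub>F y in at z. g y = g' y"
      using ev by (simp add: eventually_nhds_conv_at)
  qed (use eventually_nhds_x_imp_x[OF ev] in auto)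
  then show ?thesis
    by (rule has_derivative_unique[OF _ g'(2)])
qed

lemma hessian_eqI: "has_hessian f H z \<Longrightarrow> hessian f z = H"
  unfolding hessian_def using has_hessian_unique by blast

definition transport_cost :: "(real^'n \<Rightarrow> real^'n^'n) \<Rightarrow> real^'n \<Rightarrow> real^'n \<Rightarrow> real" where
  "transport_cost A x x' = (x - x') \<bullet> (A x *v (x - x'))"

text \<open>The growth rate lives in \<^typ>\<open>ereal\<close> so that the infimum of the empty set is \<open>\<infinity>\<close>.\<close>

definition growth_rate :: "(real \<Rightarrow> real) \<Rightarrow> ereal" where
  "growth_rate l = Inf {ereal s | s. 0 \<le> s \<and> (SUP u. ereal (l u - s * u\<^sup>2)) < \<infinity>}"

definition dual_objective ::
  "(real^'n \<Rightarrow> real^'n^'n) \<Rightarrow> (real \<Rightarrow> real) \<Rightarrow> real \<Rightarrow>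
   real \<Rightarrow> real^'n \<Rightarrow> real \<Rightarrow> real^'n \<Rightarrow> real" where
  "dual_objective A l \<delta> \<gamma> \<beta> lam x =
     l (\<beta> \<bullet> x + \<gamma> * sqrt \<delta> * (\<beta> \<bullet> (matrix_inv (A x) *v \<beta>)))
     - lam * sqrt \<delta> * (\<gamma>\<^sup>2 * (\<beta> \<bullet> (matrix_inv (A x) *v \<beta>)) - 1)"

definition robust_loss ::
  "(real^'n \<Rightarrow> real^'n^'n) \<Rightarrow> (real \<Rightarrow> real) \<Rightarrow> real \<Rightarrow>
   real^'n \<Rightarrow> real \<Rightarrow> real^'n \<Rightarrow> ereal" where
  "robust_loss A l \<delta> \<beta> lam x = (SUP \<gamma>. ereal (dual_objective A l \<delta> \<gamma> \<beta> lam x))"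

definition dro_objective ::
  "(real^'n) measure \<Rightarrow> (real^'n \<Rightarrow> real^'n^'n) \<Rightarrow> (real \<Rightarrow> real) \<Rightarrow> real \<Rightarrow>
   (real^'n) \<times> real \<Rightarrow> ereal" where
  "dro_objective P0 A l \<delta> = (\<lambda>(\<beta>, lam). ext_expectation P0 (robust_loss A l \<delta> \<beta> lam))"

definition deriv_second_moment_bounds ::
  "(real^'n) measure \<Rightarrow> (real \<Rightarrow> real) \<Rightarrow> (real^'n) set \<Rightarrow> real \<Rightarrow> real \<Rightarrow> bool" where
  "deriv_second_moment_bounds P0 l B L U \<longleftrightarrow>
     0 < L \<and> 0 < U \<and>
     (\<forall>\<beta>\<in>B. integrable P0 (\<lambda>x. (deriv l (\<beta> \<bullet> x))\<^sup>2) \<and>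
        L \<le> (\<integral>x. (deriv l (\<beta> \<bullet> x))\<^sup>2 \<partial>P0) \<and> (\<integral>x. (deriv l (\<beta> \<bullet> x))\<^sup>2 \<partial>P0) \<le> U)"

definition radius :: "(real^'n) set \<Rightarrow> real" where
  "radius B = (SUP \<beta>\<in>B. norm \<beta>)"

definition K1 :: "real \<Rightarrow> real \<Rightarrow> real" where
  "K1 L \<rho>max = 1/2 * sqrt (L * inverse \<rho>max)"

definition K2 :: "real \<Rightarrow> real \<Rightarrow> real \<Rightarrow> real \<Rightarrow> real \<Rightarrow> real" where
  "K2 \<delta> M R \<rho>min U = 1/2 * sqrt \<delta> * M * R * inverse \<rho>min + sqrt (inverse \<rho>min * U)"

text \<open>If \<open>0 \<in> B\<close>, the region contains the apex \<open>(0, 0)\<close>. There the objective is not differentiable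
  (it is infinite at points \<open>(\<beta>, 0)\<close> with \<open>\<beta> \<noteq> 0\<close> arbitrarily close by) and the weight \<open>1 / lam\<close> in the
  strong convexity bound is undefined. Moreover the Hessian may grow like \<open>1 / lam\<close> towards the
  apex, as for \<open>l u = u\<close> and \<open>A x = mat 1\<close>.\<close>

definition V_region ::
  "(real^'n) set \<Rightarrow> real \<Rightarrow> real \<Rightarrow> ((real^'n) \<times> real) set" where
  "V_region B k1 k2 =
     {(\<beta>, lam). \<beta> \<in> B \<and> 0 \<le> lam \<and> k1 * norm \<beta> \<le> lam \<and> lam \<le> k2 * norm \<beta>}"

end

theory Submission
  imports Defs
begin

text \<open>With \<open>Q = A(x)\<^sup>-\<^sup>1\<close>, \<open>s = sqrt \<delta>\<close> and \<open>q = \<beta> \<bullet> Q \<beta>\<close>, the supremum over \<open>\<gamma>\<close> is attained, as soon as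
  \<open>s M q \<le> \<lambda>\<close>, at the unique root of \<open>l'(\<beta> \<bullet> x + \<gamma> s q) = 2 \<lambda> \<gamma>\<close>. Implicit differentiation (which needs
  \<open>l'\<close> to be differentiable, not \<open>C\<^sup>1\<close>) gives the gradient \<open>(2 \<lambda> \<gamma> (x + s \<gamma> Q \<beta>), s (1 - \<gamma>\<^sup>2 q))\<close> and the
  \<open>\<beta>\<close>-block \<open>2 \<lambda> l'' / (2 \<lambda> - s q l'') y y\<^sup>T + 2 \<lambda> s \<gamma>\<^sup>2 Q\<close> of the Hessian, with \<open>y = x + 2 s \<gamma> Q \<beta>\<close>. These are
  \<open>O((1 + \<bar>x\<bar>)\<^sup>2)\<close> locally uniformly in \<open>(\<beta>, \<lambda>)\<close>, so one may differentiate twice under the expectation.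
  As \<open>2 \<lambda> \<bar>\<gamma>\<bar> \<ge> \<bar>l'(\<beta> \<bullet> x)\<bar>\<close>, the second summand has expectation at least \<open>s L / (2 \<lambda> \<rho>max)\<close>.\<close>

subsection \<open>Differentiation\<close>

text \<open>The condition \<open>s M q \<le> \<lambda>\<close> depends on \<open>x\<close> through
  \<open>q\<close>, whereas differentiating under the expectation needs one neighbourhood of
  \<open>(\<beta>, \<lambda>)\<close> that serves every \<open>x\<close>. Since
  \<open>q \<le> cu |\<beta>|^2\<close> with \<open>cu = 1 / \<rho>min\<close>, the set
  \<open>dom\<close> of pairs with \<open>s M cu |\<beta>|^2 < \<lambda>\<close> has this property;
  being open in the whole space, it also gives full derivatives at boundary points of
  \<open>B\<close>. On the region, \<open>\<lambda> \<ge> K1 |\<beta>|\<close> beats the quadratic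
  term once \<open>s\<close> is small against \<open>K1 \<rho>min / (M R)\<close>, where
  \<open>R\<close> bounds \<open>B\<close>: this is the origin of the threshold for
  \<open>\<delta>\<close>. Only the apex escapes. The factor 2 in the first-order condition leaves a
  slope of at least \<open>\<lambda>\<close> in \<open>\<gamma>\<close> throughout
  \<open>dom\<close>. Existence, uniqueness, continuity, growth and measurability of the root all
  come from this one estimate. The matrix bounds hold only almost surely. To have estimates at every
  \<open>x\<close>, the inverse matrix is replaced on a null set by a multiple of the identity,
  which leaves the expectation unchanged.\<close>

text \<open>Where \<open>w\<close> vanishes, the product rule has no term with a derivative of
  \<open>c\<close>, so continuity of \<open>c\<close> suffices. In \<open>gam_deriv\<close> the
  factor \<open>c\<close> contains a difference slope that is known to be continuous at one point
  only.\<close>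

lemma has_derivative_mult_vanishing:
  fixes c w :: "'a::real_normed_vector \<Rightarrow> real"
  assumes c: "isCont c p" and w: "(w has_derivative w') (at p)" and w0: "w p = 0"
  shows "((\<lambda>x. c x * w x) has_derivative (\<lambda>h. c p * w' h)) (at p)"
proof -
  interpret w': bounded_linear w' using has_derivative_bounded_linear[OF w] .
  obtain K where K: "\<And>h. norm (w' h) \<le> norm h * K" "K > 0"
    using w'.pos_bounded by blast
  let ?r = "\<lambda>y. norm (w y - w p - w' (y - p)) / norm (y - p)"
  have r: "(?r \<longlongrightarrow> 0) (at p)"
    using w unfolding has_derivative_iff_norm by blast
  have c': "(c \<longlongrightarrow> c p) (at p)"
    using c by (simp add: isCont_def)
  show ?thesis
  proof (rule has_derivativeI_sandwich[of 1])
    show "bounded_linear (\<lambda>h. c p * w' h)"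
      by (intro bounded_linear_intros w'.bounded_linear_axioms)
    show "((\<lambda>y. \<bar>c y\<bar> * ?r y + \<bar>c y - c p\<bar> * K) \<longlongrightarrow> 0) (at p)"
      by (rule tendsto_eq_intros r c' | simp)+
    fix y assume "y \<noteq> p"
    then have n: "norm (y - p) > 0" by simp
    have "c y * w y - c p * w p - c p * w' (y - p)
        = c y * (w y - w p - w' (y - p)) + (c y - c p) * w' (y - p)"
      by (simp add: w0 algebra_simps)
    also have "norm \<dots> \<le> \<bar>c y\<bar> * norm (w y - w p - w' (y - p)) + \<bar>c y - c p\<bar> * norm (w' (y - p))"
      by (rule order.trans[OF norm_triangle_ineq]) (simp add: abs_mult)
    also have "\<dots> \<le> \<bar>c y\<bar> * norm (w y - w p - w' (y - p)) + \<bar>c y - c p\<bar> * (norm (y - p) * K)"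
      by (intro add_left_mono mult_left_mono K) auto
    also have "\<dots> = (\<bar>c y\<bar> * ?r y + \<bar>c y - c p\<bar> * K) * norm (y - p)"
      using n by (simp add: field_simps)
    finally show "norm (c y * w y - c p * w p - c p * w' (y - p)) / norm (y - p)
        \<le> \<bar>c y\<bar> * ?r y + \<bar>c y - c p\<bar> * K"
      using n by (simp add: divide_le_eq)
  qed simp
qed

text \<open>By the mean value inequality on the convex set \<open>S\<close>, the bound on
  \<open>D\<close> makes \<open>G\<close> Lipschitz in \<open>y\<close> with constant
  \<open>K x\<close>. The normalised remainder at \<open>z\<close> is then dominated by
  \<open>2 * K x\<close>, and dominated convergence applies. No continuity of \<open>D\<close> in
  \<open>y\<close> enters, which matters because \<open>l2\<close> may be discontinuous.\<close>

lemma has_derivative_integral: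
  fixes G :: "'a::euclidean_space \<Rightarrow> 'b \<Rightarrow> 'c::euclidean_space"
  assumes S: "convex S" "open S" "z \<in> S"
    and der: "\<And>y x. y \<in> S \<Longrightarrow> ((\<lambda>y. G y x) has_derivative D y x) (at y)"
    and bound: "\<And>y x h. y \<in> S \<Longrightarrow> norm (D y x h) \<le> K x * norm h"
    and K: "integrable P K"
    and Gm: "\<And>y. y \<in> S \<Longrightarrow> G y \<in> borel_measurable P"
    and Dm: "\<And>h. (\<lambda>x. D z x h) \<in> borel_measurable P"
    and Gi: "integrable P (G z)"
  shows "\<And>y. y \<in> S \<Longrightarrow> integrable P (G y)"
    and "\<And>h. integrable P (\<lambda>x. D z x h)"
    and "((\<lambda>y. \<integral>x. G y x \<partial>P) has_derivative (\<lambda>h. \<integral>x. D z x h \<partial>P)) (at z)"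
proof -
  obtain b :: 'a where b: "b \<in> Basis" using nonempty_Basis by blast
  have K0: "0 \<le> K x" for x
    using order.trans[OF norm_ge_zero bound[OF S(3), of x b]] b by simp
  have lip: "norm (G y x - G z x) \<le> K x * norm (y - z)" if "y \<in> S" for y x
    by (rule differentiable_bound[OF S(1) has_derivative_at_withinI[OF der] _ that S(3)])
       (auto intro: onorm_le bound)
  show Gint: "integrable P (G y)" if y: "y \<in> S" for y
  proof -
    have "integrable P (\<lambda>x. G y x - G z x)"
    proof (rule Bochner_Integration.integrable_bound)
      show "integrable P (\<lambda>x. K x * norm (y - z))" using K by simp
    qed (use Gm y S lip K0 in auto)
    from Bochner_Integration.integrable_add[OF this Gi] show ?thesis by simp
  qed
  show Dint: "integrable P (\<lambda>x. D z x h)" for h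
  proof (rule Bochner_Integration.integrable_bound)
    show "integrable P (\<lambda>x. K x * norm h)" using K by simp
  qed (use Dm bound[OF S(3)] K0 in auto)
  interpret D: bounded_linear "D z x" for x
    using has_derivative_bounded_linear[OF der[OF S(3)]] .
  let ?D = "\<lambda>h. \<integral>x. D z x h \<partial>P"
  have norm_D: "norm (?D h) \<le> norm h * (\<integral>x. K x \<partial>P)" for h
  proof -
    have "norm (?D h) \<le> (\<integral>x. K x * norm h \<partial>P)"
      by (rule order.trans[OF integral_norm_bound])
         (intro integral_mono integrable_norm Dint integrable_mult_left K bound S)
    then show ?thesis by (simp add: mult.commute)
  qed
  have bl: "bounded_linear ?D"
  proof
    show "?D (x + y) = ?D x + ?D y" for x y
      using Dint by (simp add: D.add)
    show "?D (r *\<^sub>R x) = r *\<^sub>R ?D x" for r x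
      by (simp add: D.scaleR)
    show "\<exists>K. \<forall>x. norm (?D x) \<le> norm x * K"
      using norm_D by blast
  qed
  let ?R = "\<lambda>y x. norm (G y x - G z x - D z x (y - z)) / norm (y - z)"
  have R0: "((\<lambda>y. ?R y x) \<longlongrightarrow> 0) (at z)" for x
    using der[OF S(3)] unfolding has_derivative_iff_norm by blast
  have Rb: "?R y x \<le> 2 * K x" if "y \<in> S" for y x
  proof (cases "y = z")
    case False
    have "norm (G y x - G z x - D z x (y - z)) \<le> K x * norm (y - z) + K x * norm (y - z)"
      by (rule order.trans[OF norm_triangle_ineq4]) (intro add_mono lip that bound S)
    then show ?thesis using False by (simp add: divide_le_eq)
  qed (simp add: K0)
  have Rm: "?R y \<in> borel_measurable P" if "y \<in> S" for y
    using Gm[OF that] Gm[OF S(3)] Dm[of "y - z"] by measurable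
  have lim: "((\<lambda>y. \<integral>x. ?R y x \<partial>P) \<longlongrightarrow> 0) (at z within S)"
    unfolding tendsto_at_iff_sequentially
  proof safe
    fix X :: "nat \<Rightarrow> 'a" assume X: "\<forall>i. X i \<in> S - {z}" "X \<longlonglongrightarrow> z"
    have "(\<lambda>n. \<integral>x. ?R (X n) x \<partial>P) \<longlonglongrightarrow> (\<integral>x. 0 \<partial>P)"
    proof (rule integral_dominated_convergence)
      show "integrable P (\<lambda>x. 2 * K x)" using K by simp
      show "AE x in P. (\<lambda>n. ?R (X n) x) \<longlonglongrightarrow> 0"
        using R0 X unfolding tendsto_at_iff_sequentially by (auto simp: comp_def)
      show "AE x in P. norm (?R (X n) x) \<le> 2 * K x" for n
        using Rb[of "X n"] X by auto
    qed (use Rm X in auto)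
    then show "((\<lambda>y. \<integral>x. ?R y x \<partial>P) \<circ> X) \<longlonglongrightarrow> 0"
      by (simp add: comp_def)
  qed
  have "((\<lambda>y. \<integral>x. G y x \<partial>P) has_derivative ?D) (at z within S)"
  proof (rule has_derivativeI_sandwich[of 1])
    fix y assume y: "y \<in> S" "y \<noteq> z"
    have "(\<integral>x. G y x \<partial>P) - (\<integral>x. G z x \<partial>P) - ?D (y - z) = (\<integral>x. G y x - G z x - D z x (y - z) \<partial>P)"
      using Gint y S Dint by simp
    then have "norm ((\<integral>x. G y x \<partial>P) - (\<integral>x. G z x \<partial>P) - ?D (y - z))
        \<le> (\<integral>x. norm (G y x - G z x - D z x (y - z)) \<partial>P)"
      by (metis integral_norm_bound)
    then have "norm ((\<integral>x. G y x \<partial>P) - (\<integral>x. G z x \<partial>P) - ?D (y - z)) / norm (y - z)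
        \<le> (\<integral>x. norm (G y x - G z x - D z x (y - z)) \<partial>P) / norm (y - z)"
      by (rule divide_right_mono) simp
    also have "\<dots> = (\<integral>x. ?R y x \<partial>P)" by simp
    finally show "norm ((\<integral>x. G y x \<partial>P) - (\<integral>x. G z x \<partial>P) - ?D (y - z)) / norm (y - z) \<le> (\<integral>x. ?R y x \<partial>P)" .
  qed (use lim bl in auto)
  then show "((\<lambda>y. \<integral>x. G y x \<partial>P) has_derivative ?D) (at z)"
    using S at_within_open by metis
qed

text \<open>Passage from the extended expectation to a Bochner integral. Equality almost everywhere
  absorbs the null set on which the inverse matrix is later modified.\<close>

lemma ext_expectation_integrable:
  assumes f: "integrable P f" and Y: "AE x in P. Y x = ereal (f x)"
  shows "ext_expectation P Y = ereal (\<integral>x. f x \<partial>P)"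
proof -
  have "(\<integral>\<^sup>+x. e2ennreal (Y x) \<partial>P) = (\<integral>\<^sup>+x. ennreal (f x) \<partial>P)"
    "(\<integral>\<^sup>+x. e2ennreal (- Y x) \<partial>P) = (\<integral>\<^sup>+x. ennreal (- f x) \<partial>P)"
    using Y by (auto intro!: nn_integral_cong_AE)
  moreover have "(\<integral>\<^sup>+x. ennreal (f x) \<partial>P) < \<infinity>" "(\<integral>\<^sup>+x. ennreal (- f x) \<partial>P) < \<infinity>"
    using f by (auto simp: real_integrable_def top.not_eq_extremum)
  ultimately show ?thesis
    unfolding ext_expectation_def real_lebesgue_integral_def[OF f]
    by (cases "\<integral>\<^sup>+x. ennreal (f x) \<partial>P"; cases "\<integral>\<^sup>+x. ennreal (- f x) \<partial>P")
       (auto simp: enn2ereal_ennreal)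
qed

text \<open>Chain rule along the affine inclusion of a slice. It identifies the Hessian in
  \<open>\<beta>\<close> alone with a diagonal block of the joint Hessian.\<close>

lemma has_hessian_fst:
  fixes f :: "'a::euclidean_space \<times> 'b::euclidean_space \<Rightarrow> ereal"
  assumes "has_hessian f H (a, c)"
  shows "has_hessian (\<lambda>b. f (b, c)) (\<lambda>h. fst (H (h, 0))) a"
proof -
  obtain g where ev: "\<forall>\<^sub>F y in nhds (a, c). \<bar>f y\<bar> \<noteq> \<infinity> \<and>
        ((\<lambda>w. real_of_ereal (f w)) has_derivative (\<lambda>h. g y \<bullet> h)) (at y)"
    and g: "(g has_derivative H) (at (a, c))"
    using assms unfolding has_hessian_def by blast
  have incl: "((\<lambda>b. (b, c)) has_derivative (\<lambda>h. (h, 0))) (at b)" for b :: 'a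
    by (auto intro!: derivative_eq_intros)
  have "((\<lambda>b. (b, c)) \<longlongrightarrow> (a, c)) (nhds a)"
    by (intro tendsto_intros filterlim_ident)
  then have ev': "\<forall>\<^sub>F b in nhds a. \<bar>f (b, c)\<bar> \<noteq> \<infinity> \<and>
        ((\<lambda>w. real_of_ereal (f w)) has_derivative (\<lambda>h. g (b, c) \<bullet> h)) (at (b, c))"
    by (rule eventually_compose_filterlim[OF ev])
  show ?thesis
    unfolding has_hessian_def
  proof (intro exI conjI)
    show "\<forall>\<^sub>F y in nhds a. \<bar>f (y, c)\<bar> \<noteq> \<infinity> \<and>
       ((\<lambda>w. real_of_ereal (f (w, c))) has_derivative (\<bullet>) (fst (g (y, c)))) (at y)"
      using ev'
    proof eventually_elim
      case (elim y)
      have "((\<lambda>w. real_of_ereal (f (w, c))) has_derivative (\<lambda>h. g (y, c) \<bullet> (h, 0))) (at y)"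
        using has_derivative_compose[OF incl, of "\<lambda>w. real_of_ereal (f w)"] elim by blast
      then show ?case using elim by (simp add: inner_prod_def)
    qed
    show "((\<lambda>b. fst (g (b, c))) has_derivative (\<lambda>h. fst (H (h, 0)))) (at a)"
      by (intro has_derivative_fst has_derivative_compose[OF incl g])
  qed
qed

subsection \<open>The inner maximisation\<close>

text \<open>\<open>Q x\<close> stands for the inverse of \<open>A x\<close> after correction on a
  null set, so its bounds hold at every \<open>x\<close>. The instance is
  \<open>s = sqrt \<delta>\<close>, \<open>cl = inverse \<rho>max\<close>,
  \<open>cu = inverse \<rho>min\<close>.\<close>

locale robust_dual =
  fixes P :: "'a::euclidean_space measure" and Q :: "'a \<Rightarrow> 'a \<Rightarrow> 'a"
    and l l1 l2 :: "real \<Rightarrow> real" and M s cl cu :: real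
  assumes P: "prob_space P" "sets P = sets borel" "integrable P (\<lambda>x. (norm x)\<^sup>2)"
    and Q_linear: "\<And>x. bounded_linear (Q x)"
    and Q_sym: "\<And>x v w. v \<bullet> Q x w = Q x v \<bullet> w"
    and Q_lower: "\<And>x v. cl * (norm v)\<^sup>2 \<le> v \<bullet> Q x v"
    and Q_upper: "\<And>x v. norm (Q x v) \<le> cu * norm v"
    and Q_measurable: "\<And>v. (\<lambda>x. Q x v) \<in> borel_measurable borel"
    and pos: "0 < cl" "0 < cu" "0 < s" "0 < M"
    and l_deriv: "\<And>u. (l has_real_derivative l1 u) (at u)"
    and l1_deriv: "\<And>u. (l1 has_real_derivative l2 u) (at u)"
    and l2_bounds: "\<And>u. 0 \<le> l2 u" "\<And>u. l2 u \<le> M"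
begin

section \<open>Slope and quadratic bounds for the loss\<close>

lemma l1_slope:
  assumes "a \<le> b"
  shows "l1 a \<le> l1 b" "l1 b - l1 a \<le> M * (b - a)"
proof -
  show "l1 a \<le> l1 b"
    using DERIV_nonneg_imp_nondecreasing[OF assms, of l1] l1_deriv l2_bounds by blast
  have "((\<lambda>u. M * u - l1 u) has_real_derivative (M - l2 u)) (at u)" for u
    by (auto intro!: derivative_eq_intros l1_deriv)
  then have "M * a - l1 a \<le> M * b - l1 b"
    using DERIV_nonneg_imp_nondecreasing[OF assms, of "\<lambda>u. M * u - l1 u"] l2_bounds
    by (meson diff_ge_0_iff_ge)
  then show "l1 b - l1 a \<le> M * (b - a)" by (simp add: algebra_simps)
qed

lemma l1_lipschitz: "\<bar>l1 b - l1 a\<bar> \<le> M * \<bar>b - a\<bar>"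
  using l1_slope[of a b] l1_slope[of b a] by (cases "a \<le> b") (auto simp: abs_if)

lemma l1_growth: "\<bar>l1 u\<bar> \<le> \<bar>l1 0\<bar> + M * \<bar>u\<bar>"
  using l1_lipschitz[of u 0] by simp

lemma DERIV_sign_minimum:
  fixes f :: "real \<Rightarrow> real"
  assumes "\<And>w. (f has_real_derivative f' w) (at w)"
    and "\<And>w. u \<le> w \<Longrightarrow> 0 \<le> f' w" "\<And>w. w \<le> u \<Longrightarrow> f' w \<le> 0"
  shows "f u \<le> f v"
proof (cases "u \<le> v")
  case True
  then show ?thesis by (rule DERIV_nonneg_imp_nondecreasing) (use assms in blast)
next
  case False
  then have "v \<le> u" by simp
  then show ?thesis by (rule DERIV_nonpos_imp_nonincreasing) (use assms in blast)
qed

text \<open>As a function of \<open>v\<close>, the right side minus the left has a derivative with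
  the sign of \<open>v - u\<close>, so its minimum is the value 0 at \<open>v = u\<close>. The
  tangent bound \<open>l_lower\<close> is obtained in the same way.\<close>

lemma l_quadratic_upper: "l v \<le> l u + l1 u * (v - u) + M / 2 * (v - u)\<^sup>2"
proof -
  have "((\<lambda>v. l u + l1 u * (v - u) + M / 2 * (v - u)\<^sup>2 - l v) has_real_derivative
      (l1 u + M * (w - u) - l1 w)) (at w)" for w
    by (auto intro!: derivative_eq_intros l_deriv)
  from DERIV_sign_minimum[OF this, of u v] show ?thesis
    using l1_slope(2)[of u] l1_slope(2)[of _ u] by (simp add: algebra_simps)
qed

lemma l_lower: "l u + l1 u * (v - u) \<le> l v"
proof -
  have "((\<lambda>v. l v - l u - l1 u * (v - u)) has_real_derivative (l1 w - l1 u)) (at w)" for w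
    by (auto intro!: derivative_eq_intros l_deriv)
  from DERIV_sign_minimum[OF this, of u v] show ?thesis
    using l1_slope(1)[of u] l1_slope(1)[of _ u] by (simp add: algebra_simps)
qed

section \<open>The first-order condition and its root\<close>

definition q :: "'a \<times> real \<Rightarrow> 'a \<Rightarrow> real" where
  "q p x = fst p \<bullet> Q x (fst p)"

definition shifted :: "'a \<times> real \<Rightarrow> 'a \<Rightarrow> real \<Rightarrow> real" where
  "shifted p x g = fst p \<bullet> x + g * s * q p x"

text \<open>Bounding \<open>q p x\<close> by \<open>cu * (norm (fst p))\<^sup>2\<close> removes
  \<open>x\<close> from the condition; the strict inequality makes the set open and forces
  \<open>snd p\<close> to be positive.\<close>

definition dom :: "('a \<times> real) set" where
  "dom = {p. s * M * cu * (norm (fst p))\<^sup>2 < snd p}"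

text \<open>The first-order condition \<open>resid p x g = 0\<close> characterises the maximiser over \<open>g\<close>.\<close>

definition resid :: "'a \<times> real \<Rightarrow> 'a \<Rightarrow> real \<Rightarrow> real" where
  "resid p x g = 2 * snd p * g - l1 (shifted p x g)"

definition gam :: "'a \<times> real \<Rightarrow> 'a \<Rightarrow> real" where
  "gam p x = (THE g. resid p x g = 0)"

definition u :: "'a \<times> real \<Rightarrow> 'a \<Rightarrow> real" where
  "u p x = shifted p x (gam p x)"

lemma open_dom: "open dom"
  unfolding dom_def by (intro open_Collect_less continuous_intros)

lemma q_bounds: "0 \<le> q p x" "q p x \<le> cu * (norm (fst p))\<^sup>2"
proof -
  show "0 \<le> q p x"
    unfolding q_def using Q_lower[of "fst p" x] pos
    by (meson order.trans mult_nonneg_nonneg less_imp_le zero_le_power2)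
  have "q p x \<le> norm (fst p) * norm (Q x (fst p))"
    unfolding q_def by (rule norm_cauchy_schwarz)
  also have "\<dots> \<le> norm (fst p) * (cu * norm (fst p))"
    by (intro mult_left_mono Q_upper) auto
  finally show "q p x \<le> cu * (norm (fst p))\<^sup>2" by (simp add: power2_eq_square ac_simps)
qed

lemma dom_pos: "p \<in> dom \<Longrightarrow> 0 < snd p"
  unfolding dom_def using pos
  by (smt (verit) mem_Collect_eq mult_nonneg_nonneg zero_le_power2)

lemma dom_q:
  assumes "p \<in> dom" shows "s * M * q p x \<le> snd p"
proof -
  have "s * M * q p x \<le> s * M * (cu * (norm (fst p))\<^sup>2)"
    using pos by (intro mult_left_mono q_bounds) auto
  then show ?thesis using assms by (simp add: dom_def mult.assoc)
qed

text \<open>The slope of \<open>resid\<close> in \<open>g\<close> is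
  \<open>2 * snd p - s * q p x * l2\<close>, and on \<open>dom\<close> the subtracted term is at
  most \<open>snd p\<close>. Working with increments of \<open>l1\<close> gives the bound for finite
  differences directly.\<close>

lemma resid_strongly_mono:
  assumes p: "p \<in> dom" and g: "g \<le> g'"
  shows "snd p * (g' - g) \<le> resid p x g' - resid p x g"
proof -
  have "shifted p x g \<le> shifted p x g'"
    unfolding shifted_def using g pos q_bounds by (simp add: mult_right_mono)
  then have "l1 (shifted p x g') - l1 (shifted p x g) \<le> M * (shifted p x g' - shifted p x g)"
    by (rule l1_slope)
  also have "\<dots> = (s * M * q p x) * (g' - g)" by (simp add: shifted_def algebra_simps)
  also have "\<dots> \<le> snd p * (g' - g)"
    using g by (intro mult_right_mono dom_q p) auto
  finally show ?thesis by (simp add: resid_def algebra_simps)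
qed

lemma resid_ex1:
  assumes p: "p \<in> dom" shows "\<exists>!g. resid p x g = 0"
proof -
  have t: "0 < snd p" using dom_pos p .
  \<comment> \<open>Moving from 0 to \<open>?a\<close> or \<open>- ?a\<close> changes the residual
    by at least \<open>\<bar>resid p x 0\<bar>\<close>, so its signs at the two ends bracket a
    root.\<close>
  let ?a = "\<bar>resid p x 0\<bar> / snd p"
  have a: "0 \<le> ?a" "snd p * ?a = \<bar>resid p x 0\<bar>" using t by auto
  have "resid p x (- ?a) \<le> 0" "0 \<le> resid p x ?a"
    using resid_strongly_mono[OF p, of "-?a" 0 x] resid_strongly_mono[OF p, of 0 ?a x] a by auto
  moreover have "isCont (resid p x) g" for g
  proof -
    have "isCont l1 z" for z using l1_deriv DERIV_isCont by blast
    moreover have "isCont (shifted p x) g" unfolding shifted_def by (intro continuous_intros)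
    ultimately have "isCont (\<lambda>g. l1 (shifted p x g)) g" by (rule isCont_o2[rotated])
    moreover have "isCont (\<lambda>g. 2 * snd p * g) g" by (intro continuous_intros)
    ultimately show ?thesis unfolding resid_def by (rule isCont_diff[rotated])
  qed
  ultimately obtain g where "resid p x g = 0"
    using IVT[of "resid p x" "-?a" 0 ?a] a(1) by auto
  moreover have "g = g'" if "resid p x g = 0" "resid p x g' = 0" for g g'
    using resid_strongly_mono[OF p, of g g' x] resid_strongly_mono[OF p, of g' g x] that t
    by (cases "g \<le> g'") (auto simp: mult_le_0_iff)
  ultimately show ?thesis by blast
qed

lemma resid_gam: "p \<in> dom \<Longrightarrow> resid p x (gam p x) = 0"
  unfolding gam_def by (rule theI'[OF resid_ex1])

lemma l1_u: "p \<in> dom \<Longrightarrow> l1 (u p x) = 2 * snd p * gam p x"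
  using resid_gam[of p x] by (simp add: resid_def u_def)

text \<open>An error bound for an arbitrary trial value \<open>g\<close>. Taking
  \<open>g = 0\<close> bounds the growth of \<open>gam\<close>; taking the root at a nearby
  parameter as trial value gives continuity.\<close>

lemma gam_dist:
  assumes p: "p \<in> dom" shows "\<bar>gam p x - g\<bar> \<le> \<bar>resid p x g\<bar> / snd p"
  using resid_strongly_mono[OF p, of g "gam p x" x] resid_strongly_mono[OF p, of "gam p x" g x]
    resid_gam[OF p, of x] dom_pos[OF p]
  by (cases "g \<le> gam p x") (auto simp: pos_le_divide_eq mult.commute)

text \<open>Monotonicity of \<open>resid\<close> turns sublevel sets of the implicitly defined root
  into explicit sets, whence its measurability in \<open>x\<close>.\<close>

lemma gam_le_iff:
  assumes p: "p \<in> dom" shows "gam p x \<le> c \<longleftrightarrow> 0 \<le> resid p x c"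
proof
  show "gam p x \<le> c \<Longrightarrow> 0 \<le> resid p x c"
    using resid_strongly_mono[OF p, of "gam p x" c x] resid_gam[OF p, of x] dom_pos[OF p]
    by (auto elim: order.trans[rotated])
  show "0 \<le> resid p x c \<Longrightarrow> gam p x \<le> c"
    using resid_strongly_mono[OF p, of c "gam p x" x] resid_gam[OF p, of x] dom_pos[OF p]
      mult_pos_pos[of "snd p" "gam p x - c"]
    by linarith
qed

section \<open>Measurability in the sample point\<close>

lemma l1_measurable [measurable]: "l1 \<in> borel_measurable borel"
  by (intro borel_measurable_continuous_onI continuous_at_imp_continuous_on)
     (use l1_deriv DERIV_isCont in blast)

lemma l_measurable [measurable]: "l \<in> borel_measurable borel"
  by (intro borel_measurable_continuous_onI continuous_at_imp_continuous_on)
     (use l_deriv DERIV_isCont in blast)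

text \<open>Possibly discontinuous, \<open>l2\<close> is still a pointwise limit of difference
  quotients of the continuous function \<open>l1\<close>.\<close>

lemma l2_measurable [measurable]: "l2 \<in> borel_measurable borel"
proof (rule borel_measurable_LIMSEQ_real)
  show "(\<lambda>n. (l1 (u + 1 / real (Suc n)) - l1 u) / (1 / real (Suc n))) \<longlonglongrightarrow> l2 u" for u
  proof -
    have "filterlim (\<lambda>n. 1 / real (Suc n)) (at 0) sequentially"
      using LIMSEQ_inverse_real_of_nat by (auto simp: filterlim_at divide_inverse)
    then show ?thesis
      using l1_deriv[of u] unfolding DERIV_def by (rule filterlim_compose[rotated])
  qed
qed measurable

lemma Q_measurable' [measurable]: "(\<lambda>x. Q x v) \<in> borel_measurable borel"
  by (rule Q_measurable)

lemma q_measurable [measurable]: "q p \<in> borel_measurable borel"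
  unfolding q_def by measurable

lemma gam_measurable:
  assumes p: "p \<in> dom" shows "gam p \<in> borel_measurable borel"
proof (rule borel_measurableI_le)
  fix c
  have "{x \<in> space borel. gam p x \<le> c} = {x \<in> space borel. 0 \<le> resid p x c}"
    using gam_le_iff[OF p] by auto
  also have "\<dots> \<in> sets borel" unfolding resid_def shifted_def by measurable
  finally show "{x \<in> space borel. gam p x \<le> c} \<in> sets borel" .
qed

section \<open>Comparison of the root with the derivative of the loss\<close>

lemma gam_upper:
  assumes p: "p \<in> dom" shows "\<bar>gam p x\<bar> \<le> \<bar>l1 (fst p \<bullet> x)\<bar> / snd p"
  using gam_dist[OF p, of x 0] by (simp add: resid_def shifted_def)

text \<open>The shift from \<open>fst p \<bullet> x\<close> to the maximising argument has the sign
  of \<open>gam p x\<close> and changes \<open>l1\<close> by at most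
  \<open>snd p * \<bar>gam p x\<bar>\<close>. Hence \<open>l1 (fst p \<bullet> x)\<close> lies
  between \<open>snd p * gam p x\<close> and \<open>2 * snd p * gam p x\<close>, which also settles
  its sign.\<close>

lemma gam_lower:
  assumes p: "p \<in> dom" shows "\<bar>l1 (fst p \<bullet> x)\<bar> \<le> 2 * snd p * \<bar>gam p x\<bar>"
proof -
  have t: "0 < snd p" using dom_pos p .
  have e: "l1 (fst p \<bullet> x + gam p x * s * q p x) = 2 * snd p * gam p x"
    using l1_u[OF p, of x] unfolding u_def shifted_def .
  have sq: "0 \<le> s * q p x" using pos q_bounds by auto
  have b: "s * M * q p x \<le> snd p" using dom_q p .
  show ?thesis
  proof (cases "0 \<le> gam p x")
    case True
    have *: "fst p \<bullet> x \<le> fst p \<bullet> x + gam p x * s * q p x"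
      using mult_nonneg_nonneg[OF True sq] by (simp add: mult.assoc)
    have "2 * snd p * gam p x - l1 (fst p \<bullet> x) \<le> (s * M * q p x) * gam p x"
      using l1_slope(2)[OF *] unfolding e by (simp add: algebra_simps)
    also have "\<dots> \<le> snd p * gam p x" using b True by (rule mult_right_mono)
    finally have "0 \<le> l1 (fst p \<bullet> x)"
      using mult_nonneg_nonneg[OF less_imp_le[OF t] True] by linarith
    then show ?thesis using l1_slope(1)[OF *] unfolding e using True by simp
  next
    case False
    have *: "fst p \<bullet> x + gam p x * s * q p x \<le> fst p \<bullet> x"
      using mult_nonpos_nonneg[OF _ sq, of "gam p x"] False by (simp add: mult.assoc)
    have "l1 (fst p \<bullet> x) - 2 * snd p * gam p x \<le> (s * M * q p x) * (- gam p x)"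
      using l1_slope(2)[OF *] unfolding e by (simp add: algebra_simps)
    also have "\<dots> \<le> snd p * (- gam p x)" using b False by (intro mult_right_mono) auto
    finally have "l1 (fst p \<bullet> x) \<le> snd p * gam p x" by simp
    moreover have "snd p * gam p x < 0" using False t by (simp add: mult_pos_neg)
    ultimately show ?thesis using l1_slope(1)[OF *] unfolding e using False by simp
  qed
qed

section \<open>Derivatives of the root and of the optimal value\<close>

lemma Q_fst_deriv: "((\<lambda>p. Q x (fst p)) has_derivative (\<lambda>h. Q x (fst h))) (at p)"
  by (rule bounded_linear.has_derivative[OF Q_linear has_derivative_fst[OF has_derivative_ident]])

lemma q_deriv: "((\<lambda>p. q p x) has_derivative (\<lambda>h. 2 * (Q x (fst p) \<bullet> fst h))) (at p)"
proof -
  have "((\<lambda>p. q p x) has_derivative (\<lambda>h. fst p \<bullet> Q x (fst h) + fst h \<bullet> Q x (fst p))) (at p)"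
    unfolding q_def
    by (rule has_derivative_inner[OF has_derivative_fst[OF has_derivative_ident] Q_fst_deriv])
  moreover have "fst p \<bullet> Q x (fst h) + fst h \<bullet> Q x (fst p) = 2 * (Q x (fst p) \<bullet> fst h)" for h :: "'a \<times> real"
    using Q_sym[of "fst p" x "fst h"] inner_commute[of "fst h" "Q x (fst p)"] by simp
  ultimately show ?thesis by simp
qed

lemma resid_cont: "isCont (\<lambda>p. resid p x g) p"
proof -
  have "isCont (\<lambda>p. q p x) p" using q_deriv has_derivative_continuous by blast
  then have "isCont (\<lambda>p. shifted p x g) p"
    unfolding shifted_def by (intro continuous_add continuous_mult continuous_inner continuous_fst) auto
  moreover have "isCont l1 z" for z using l1_deriv DERIV_isCont by blast
  ultimately have "isCont (\<lambda>p. l1 (shifted p x g)) p" by (rule isCont_o2)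
  moreover have "isCont (\<lambda>p::'a \<times> real. 2 * snd p * g) p"
    by (intro continuous_mult continuous_snd) auto
  ultimately show ?thesis unfolding resid_def by (rule continuous_diff[rotated])
qed

lemma gam_cont:
  assumes p: "p \<in> dom" shows "isCont (\<lambda>p. gam p x) p"
  unfolding isCont_def
proof (rule LIM_zero_cancel[OF Lim_null_comparison])
  have ev: "\<forall>\<^sub>F p' in at p. p' \<in> dom"
    using open_dom p by (metis eventually_at_topological)
  show "\<forall>\<^sub>F p' in at p. norm (gam p' x - gam p x) \<le> \<bar>resid p' x (gam p x)\<bar> / snd p'"
    using ev
  proof eventually_elim
    case (elim p')
    have "0 < snd p'" using dom_pos[OF elim] .
    then show ?case
      using gam_dist[OF elim, of x "gam p x"] by simp
  qed
  have "((\<lambda>p'. \<bar>resid p' x (gam p x)\<bar>) \<longlongrightarrow> 0) (at p)"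
    using resid_cont[where x=x and g="gam p x" and p=p] resid_gam[OF p, of x] by (simp add: isCont_def tendsto_rabs_zero)
  then have "((\<lambda>p'. \<bar>resid p' x (gam p x)\<bar> / snd p') \<longlongrightarrow> 0 / snd p) (at p)"
    using dom_pos[OF p] by (intro tendsto_divide tendsto_snd tendsto_ident_at) auto
  then show "((\<lambda>p'. \<bar>resid p' x (gam p x)\<bar> / snd p') \<longlongrightarrow> 0) (at p)" by simp
qed

text \<open>The gradient of \<open>shifted p x g\<close> in \<open>fst p\<close>, with
  \<open>g\<close> held fixed at \<open>gam p x\<close>.\<close>

definition y :: "'a \<times> real \<Rightarrow> 'a \<Rightarrow> 'a" where
  "y p x = x + (2 * gam p x * s) *\<^sub>R Q x (fst p)"

text \<open>The derivative of \<open>resid p x g\<close> in \<open>g\<close> at the root, that is,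
  the denominator in implicit differentiation.\<close>

definition den :: "'a \<times> real \<Rightarrow> 'a \<Rightarrow> real" where
  "den p x = 2 * snd p - s * q p x * l2 (u p x)"

definition dgam :: "'a \<times> real \<Rightarrow> 'a \<Rightarrow> 'a \<times> real \<Rightarrow> real" where
  "dgam p x h = (l2 (u p x) * (y p x \<bullet> fst h) - 2 * gam p x * snd h) / den p x"

definition dual_value :: "'a \<times> real \<Rightarrow> 'a \<Rightarrow> real" where
  "dual_value p x = l (u p x) - snd p * s * ((gam p x)\<^sup>2 * q p x - 1)"

text \<open>Here \<open>l1 (u p x)\<close> is already rewritten as
  \<open>2 * snd p * gam p x\<close>. The loss then enters through \<open>gam\<close> alone, and one
  more differentiation only calls for \<open>dgam\<close>.\<close>

definition grad :: "'a \<times> real \<Rightarrow> 'a \<Rightarrow> 'a \<times> real" where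
  "grad p x = ((2 * snd p * gam p x) *\<^sub>R (x + (s * gam p x) *\<^sub>R Q x (fst p)),
     s * (1 - (gam p x)\<^sup>2 * q p x))"

text \<open>In the first component the two contributions of \<open>dgam\<close> are merged, which
  completes the vector of \<open>grad\<close> to \<open>y p x\<close>. This makes the first summand
  of the block in \<open>\<beta>\<close> a nonnegative multiple of a rank-one form on
  \<open>dom\<close>.\<close>

definition hess :: "'a \<times> real \<Rightarrow> 'a \<Rightarrow> 'a \<times> real \<Rightarrow> 'a \<times> real" where
  "hess p x h =
    ((2 * snd p * dgam p x h) *\<^sub>R y p x
       + (2 * snd h * gam p x) *\<^sub>R (x + (s * gam p x) *\<^sub>R Q x (fst p))
       + (2 * snd p * s * (gam p x)\<^sup>2) *\<^sub>R Q x (fst h),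
     - s * (2 * gam p x * dgam p x h * q p x + 2 * (gam p x)\<^sup>2 * (Q x (fst p) \<bullet> fst h)))"

lemma den_lower_slope:
  assumes p: "p \<in> dom" and c: "c \<le> M" shows "snd p \<le> 2 * snd p - s * q p x * c"
proof -
  have "s * q p x * c \<le> s * q p x * M"
    using pos q_bounds c by (intro mult_left_mono) auto
  then show ?thesis using dom_q[OF p, of x] by (simp add: ac_simps)
qed

lemma den_lower: "p \<in> dom \<Longrightarrow> snd p \<le> den p x"
  unfolding den_def by (rule den_lower_slope[OF _ l2_bounds(2)])

text \<open>Only differentiability of \<^term>\<open>l1\<close> at the single point \<^term>\<open>u p x\<close> is available, so the
  implicit equation is solved with the Caratheodory slope of \<^term>\<open>l1\<close> there.\<close>

lemma gam_deriv:
  assumes p: "p \<in> dom"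
  shows "((\<lambda>p. gam p x) has_derivative dgam p x) (at p)"
proof -
  obtain c where c: "\<And>z. l1 z - l1 (u p x) = c z * (z - u p x)" "isCont c (u p x)" "c (u p x) = l2 (u p x)"
    using l1_deriv[of "u p x"] unfolding CARAT_DERIV by auto
  define g0 where "g0 = gam p x"
  define C where "C p' = c (u p' x)" for p'
  define E where "E p' = 2 * snd p' - s * q p' x * C p'" for p'
  \<comment> \<open>The change of \<open>u\<close> with the root frozen at \<open>g0\<close>. The
    remaining change is \<open>s * q p' x * (gam p' x - g0)\<close>.\<close>
  define w where "w p' = (fst p' - fst p) \<bullet> x + s * g0 * (q p' x - q p x)" for p' :: "'a \<times> real"
  have u_p: "isCont (\<lambda>p. u p x) p"
    unfolding u_def shifted_def
    using gam_cont[OF p] has_derivative_continuous[OF q_deriv]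
    by (intro continuous_add continuous_mult continuous_inner continuous_fst) auto
  have C: "isCont C p" "C p = l2 (u p x)"
    unfolding C_def using isCont_o2[OF u_p c(2)] c(3) by auto
  have E: "isCont E p" "E p = den p x"
    unfolding E_def den_def using C has_derivative_continuous[OF q_deriv]
    by (auto intro!: continuous_diff continuous_mult continuous_snd)
  have Ep: "E p \<noteq> 0" using E(2) den_lower[OF p, of x] dom_pos[OF p] by simp
  have w0: "w p = 0" unfolding w_def by simp
  have w': "(w has_derivative (\<lambda>h. y p x \<bullet> fst h)) (at p)"
  proof -
    have "(w has_derivative (\<lambda>h. (fst h - 0) \<bullet> x + s * g0 * (2 * (Q x (fst p) \<bullet> fst h) - 0))) (at p)"
      unfolding w_def
      by (intro has_derivative_add has_derivative_mult_right has_derivative_diff q_deriv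
          has_derivative_inner_left has_derivative_fst has_derivative_ident has_derivative_const)
    then show ?thesis
      by (rule has_derivative_eq_rhs)
         (simp add: fun_eq_iff y_def g0_def inner_add_left inner_commute algebra_simps)
  qed
  \<comment> \<open>With the slope \<open>C\<close>, the difference of the first-order conditions at
    \<open>p'\<close> and \<open>p\<close> is an exact linear equation for
    \<open>gam p' x - g0\<close>. Its solution is a sum of products of continuous factors with
    differentiable ones vanishing at \<open>p\<close>.\<close>
  have eq: "gam p' x = g0 + (C p' / E p') * w p' + (- 2 * g0 / E p') * (snd p' - snd p)"
    if "p' \<in> dom \<and> E p' \<noteq> 0" for p'
  proof -
    have "2 * snd p' * gam p' x - 2 * snd p * g0 = C p' * (u p' x - u p x)"
      using c(1)[of "u p' x"] l1_u[of p' x] l1_u[OF p, of x] that by (simp add: C_def g0_def)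
    also have "u p' x - u p x = w p' + s * q p' x * (gam p' x - g0)"
      unfolding u_def shifted_def w_def g0_def by (simp add: inner_diff_left algebra_simps)
    finally have "E p' * (gam p' x - g0) = C p' * w p' - 2 * g0 * (snd p' - snd p)"
      unfolding E_def by (simp add: algebra_simps)
    then have "gam p' x - g0 = (C p' * w p' - 2 * g0 * (snd p' - snd p)) / E p'"
      using that by (simp add: nonzero_eq_divide_eq mult.commute)
    then show ?thesis by (simp add: diff_divide_distrib)
  qed
  have ev: "\<forall>\<^sub>F p' in at p. p' \<in> dom \<and> E p' \<noteq> 0"
  proof (rule eventually_conj)
    show "\<forall>\<^sub>F p' in at p. p' \<in> dom"
      using open_dom p by (metis eventually_at_topological)
    show "\<forall>\<^sub>F p' in at p. E p' \<noteq> 0"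
      using E(1) Ep unfolding isCont_def by (rule tendsto_imp_eventually_ne)
  qed
  have "((\<lambda>p'. g0 + (C p' / E p') * w p' + (- 2 * g0 / E p') * (snd p' - snd p)) has_derivative
      (\<lambda>h. 0 + (C p / E p) * (y p x \<bullet> fst h) + (- 2 * g0 / E p) * snd h)) (at p)"
  proof (intro has_derivative_add has_derivative_const has_derivative_mult_vanishing w' w0)
    show "isCont (\<lambda>p'. C p' / E p') p" "isCont (\<lambda>p'. - 2 * g0 / E p') p"
      using C E Ep by (auto intro!: continuous_divide)
    show "((\<lambda>p'. snd p' - snd p) has_derivative snd) (at p)"
      by (auto intro!: derivative_eq_intros)
  qed simp
  moreover have "(\<lambda>h. 0 + (C p / E p) * (y p x \<bullet> fst h) + (- 2 * g0 / E p) * snd h) = dgam p x"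
    unfolding dgam_def C(2) E(2) g0_def by (auto simp: fun_eq_iff diff_divide_distrib)
  ultimately have "((\<lambda>p'. g0 + (C p' / E p') * w p' + (- 2 * g0 / E p') * (snd p' - snd p)) has_derivative dgam p x) (at p)"
    by simp
  then show ?thesis
  proof (rule has_derivative_transform_eventually)
    show "\<forall>\<^sub>F p' in at p. g0 + (C p' / E p') * w p' + (- 2 * g0 / E p') * (snd p' - snd p) = gam p' x"
      using ev by eventually_elim (rule eq[symmetric])
    show "g0 + (C p / E p) * w p + (- 2 * g0 / E p) * (snd p - snd p) = gam p x"
      by (simp add: w0 g0_def)
  qed simp
qed

lemma u_deriv:
  assumes p: "p \<in> dom"
  shows "((\<lambda>p. u p x) has_derivative (\<lambda>h. y p x \<bullet> fst h + s * q p x * dgam p x h)) (at p)"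
proof -
  have "((\<lambda>p. u p x) has_derivative (\<lambda>h. (fst h \<bullet> x) +
      (gam p x * s * (2 * (Q x (fst p) \<bullet> fst h)) + (dgam p x h * s) * q p x))) (at p)"
    unfolding u_def shifted_def
    by (intro has_derivative_add has_derivative_mult has_derivative_mult_left q_deriv gam_deriv p
          has_derivative_inner_left has_derivative_fst has_derivative_ident)
  then show ?thesis
    by (rule has_derivative_eq_rhs) (simp add: fun_eq_iff y_def inner_add_left inner_commute algebra_simps)
qed

text \<open>Envelope argument: by the first-order condition the terms
  \<open>s * q p x * dgam p x h * l1 (u p x)\<close> and
  \<open>2 * snd p * s * gam p x * dgam p x h * q p x\<close> cancel.\<close>

lemma dual_value_deriv:
  assumes p: "p \<in> dom"
  shows "((\<lambda>p. dual_value p x) has_derivative (\<lambda>h. grad p x \<bullet> h)) (at p)"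
proof -
  have l': "((\<lambda>p. l (u p x)) has_derivative (\<lambda>h. (y p x \<bullet> fst h + s * q p x * dgam p x h) * l1 (u p x))) (at p)"
    using has_derivative_compose[OF u_deriv[OF p] l_deriv[of "u p x", unfolded has_field_derivative_def]]
    by (simp add: mult.commute)
  have "((\<lambda>p. dual_value p x) has_derivative (\<lambda>h. (y p x \<bullet> fst h + s * q p x * dgam p x h) * l1 (u p x)
     - (snd p * s * (((gam p x)\<^sup>2 * (2 * (Q x (fst p) \<bullet> fst h)) + (2 * dgam p x h * gam p x) * q p x) - 0)
       + (snd h * s) * ((gam p x)\<^sup>2 * q p x - 1)))) (at p)"
    unfolding dual_value_def
    by (intro l' has_derivative_diff has_derivative_mult has_derivative_mult_left has_derivative_const q_deriv
          has_derivative_snd has_derivative_ident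
          has_derivative_eq_rhs[OF has_derivative_power[OF gam_deriv[OF p], of _ 2]]) (simp add: fun_eq_iff)
  then show ?thesis
    by (rule has_derivative_eq_rhs)
       (simp add: fun_eq_iff l1_u[OF p] y_def grad_def inner_prod_def inner_add_left inner_commute
          power2_eq_square algebra_simps)
qed

lemma grad_deriv:
  assumes p: "p \<in> dom"
  shows "((\<lambda>p. grad p x) has_derivative hess p x) (at p)"
proof -
  note g = gam_deriv[OF p, of x]
  have g2: "((\<lambda>p. (gam p x)\<^sup>2) has_derivative (\<lambda>h. 2 * dgam p x h * gam p x)) (at p)"
    by (rule has_derivative_eq_rhs[OF has_derivative_power[OF g, of 2]]) (simp add: fun_eq_iff)
  have "((\<lambda>p. (2 * snd p * gam p x) *\<^sub>R (x + (s * gam p x) *\<^sub>R Q x (fst p))) has_derivative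
     (\<lambda>h. (2 * snd p * gam p x) *\<^sub>R (0 + ((s * gam p x) *\<^sub>R Q x (fst h) + (s * dgam p x h) *\<^sub>R Q x (fst p)))
        + (2 * snd p * dgam p x h + 2 * snd h * gam p x) *\<^sub>R (x + (s * gam p x) *\<^sub>R Q x (fst p)))) (at p)"
    by (intro has_derivative_scaleR has_derivative_mult has_derivative_mult_right has_derivative_add
        has_derivative_const g has_derivative_snd has_derivative_fst has_derivative_ident
        Q_fst_deriv)
  moreover have "((\<lambda>p. s * (1 - (gam p x)\<^sup>2 * q p x)) has_derivative
     (\<lambda>h. s * (0 - ((gam p x)\<^sup>2 * (2 * (Q x (fst p) \<bullet> fst h)) + (2 * dgam p x h * gam p x) * q p x)))) (at p)"
    by (intro has_derivative_mult_right has_derivative_diff has_derivative_const has_derivative_mult g2 q_deriv)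
  ultimately have "((\<lambda>p. grad p x) has_derivative (\<lambda>h.
     ((2 * snd p * gam p x) *\<^sub>R (0 + ((s * gam p x) *\<^sub>R Q x (fst h) + (s * dgam p x h) *\<^sub>R Q x (fst p)))
        + (2 * snd p * dgam p x h + 2 * snd h * gam p x) *\<^sub>R (x + (s * gam p x) *\<^sub>R Q x (fst p)),
      s * (0 - ((gam p x)\<^sup>2 * (2 * (Q x (fst p) \<bullet> fst h)) + (2 * dgam p x h * gam p x) * q p x))))) (at p)"
    unfolding grad_def by (rule has_derivative_Pair)
  then show ?thesis
    by (rule has_derivative_eq_rhs)
       (simp add: fun_eq_iff hess_def y_def scaleR_add_right scaleR_add_left power2_eq_square algebra_simps
          flip: scaleR_add_left)
qed

text \<open>Around the root the linear terms cancel. The penalty loses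
  \<open>snd p * s * q p x * d\<^sup>2\<close>, while the quadratic bound on \<open>l\<close>
  regains at most half of that, because \<open>s * M * q p x \<le> snd p\<close>.\<close>

lemma SUP_dual_value:
  assumes p: "p \<in> dom"
  shows "(SUP g. ereal (l (shifted p x g) - snd p * s * (g\<^sup>2 * q p x - 1))) = ereal (dual_value p x)"
proof (rule SUP_eqI)
  fix g
  define d where "d = g - gam p x"
  have "l (shifted p x g) \<le> l (u p x) + l1 (u p x) * (s * q p x * d) + M / 2 * (s * q p x * d)\<^sup>2"
    using l_quadratic_upper[of "shifted p x g" "u p x"]
    by (simp add: u_def shifted_def d_def algebra_simps)
  moreover have "M / 2 * (s * q p x * d)\<^sup>2 = (s * M * q p x) * (s * q p x * d\<^sup>2) / 2"
    by (simp add: power2_eq_square)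
  moreover have "(s * M * q p x) * (s * q p x * d\<^sup>2) \<le> snd p * (s * q p x * d\<^sup>2)"
    using dom_q[OF p] pos q_bounds by (intro mult_right_mono) auto
  moreover have "0 \<le> snd p * (s * q p x * d\<^sup>2)"
    using dom_pos[OF p] pos q_bounds by auto
  moreover have "dual_value p x - (l (u p x) + l1 (u p x) * (s * q p x * d) - snd p * s * (g\<^sup>2 * q p x - 1))
      = snd p * (s * q p x * d\<^sup>2)"
    unfolding dual_value_def l1_u[OF p] d_def by (simp add: algebra_simps power2_eq_square)
  ultimately have "l (shifted p x g) - snd p * s * (g\<^sup>2 * q p x - 1) \<le> dual_value p x"
    by linarith
  then show "ereal (l (shifted p x g) - snd p * s * (g\<^sup>2 * q p x - 1)) \<le> ereal (dual_value p x)"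
    by simp
next
  fix z assume "\<And>i. i \<in> UNIV \<Longrightarrow> ereal (l (shifted p x i) - snd p * s * (i\<^sup>2 * q p x - 1)) \<le> z"
  from this[of "gam p x"] show "ereal (dual_value p x) \<le> z"
    by (simp add: dual_value_def u_def)
qed

section \<open>Growth bounds uniform in the parameter\<close>

text \<open>Used twice: around a single point of \<open>dom\<close>, to dominate the integrands
  there, and for the part of the region away from the apex, to bound the Hessian.\<close>

definition reg :: "real \<Rightarrow> real \<Rightarrow> ('a \<times> real) set" where
  "reg m R = {p \<in> dom. m \<le> snd p \<and> norm p \<le> R}"

lemma l_growth: "\<bar>l v\<bar> \<le> \<bar>l 0\<bar> + \<bar>l1 0\<bar> * \<bar>v\<bar> + M / 2 * v\<^sup>2"
proof -
  have "\<bar>l1 0 * v\<bar> = \<bar>l1 0\<bar> * \<bar>v\<bar>" by (rule abs_mult)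
  moreover have "0 \<le> M / 2 * v\<^sup>2" using pos by simp
  ultimately show ?thesis
    using l_quadratic_upper[of v 0] l_lower[of 0 v] unfolding diff_zero by linarith
qed

context
  fixes m R :: real
  assumes m: "0 < m" and R: "0 \<le> R"
begin

text \<open>On \<open>reg m R\<close>, the constants \<open>c1\<close>, \<open>c2\<close>,
  \<open>c3\<close>, \<open>c5\<close> are the coefficients of \<open>1 + norm x\<close> in the
  bounds for \<open>gam\<close>, \<open>y\<close>, \<open>dgam\<close> (per unit of
  \<open>norm h\<close>) and \<open>u\<close>; \<open>c4\<close> bounds \<open>q\<close>
  independently of \<open>x\<close>.\<close>

definition "c1 = (\<bar>l1 0\<bar> + M * R) / m"
definition "c2 = 1 + 2 * c1 * s * cu * R"
definition "c3 = (M * c2 + 2 * c1) / m"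
definition "c4 = R * R * cu"
definition "c5 = R + c1 * s * c4"

lemma c_nonneg: "0 \<le> c1" "0 \<le> c2" "0 \<le> c3" "0 \<le> c4" "0 \<le> c5"
  unfolding c1_def c2_def c3_def c4_def c5_def using m R pos by (auto intro!: add_nonneg_nonneg)

lemma reg_norm:
  assumes "p \<in> reg m R"
  shows "p \<in> dom" "m \<le> snd p" "0 < snd p" "\<bar>snd p\<bar> \<le> R" "norm (fst p) \<le> R"
  using assms m norm_fst_le[of "fst p" "snd p"] norm_snd_le[of "snd p" "fst p"] unfolding reg_def by auto

lemma q_reg: "p \<in> reg m R \<Longrightarrow> \<bar>q p x\<bar> \<le> c4"
proof -
  assume p: "p \<in> reg m R"
  have "cu * (norm (fst p))\<^sup>2 \<le> cu * R\<^sup>2"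
    using reg_norm[OF p] pos by (intro mult_left_mono power_mono) auto
  then show ?thesis
    using q_bounds[of p x] by (simp add: c4_def power2_eq_square mult.commute mult.left_commute)
qed

lemma gam_reg:
  assumes p: "p \<in> reg m R" shows "\<bar>gam p x\<bar> \<le> c1 * (1 + norm x)"
proof -
  note r = reg_norm[OF p]
  have "\<bar>fst p \<bullet> x\<bar> \<le> R * norm x"
    using Cauchy_Schwarz_ineq2[of "fst p" x] mult_right_mono[OF r(5), of "norm x"] by simp
  then have "\<bar>l1 (fst p \<bullet> x)\<bar> \<le> \<bar>l1 0\<bar> + M * (R * norm x)"
    using l1_growth[of "fst p \<bullet> x"] mult_left_mono[of "\<bar>fst p \<bullet> x\<bar>" "R * norm x" M] pos by linarith
  also have "\<dots> \<le> (\<bar>l1 0\<bar> + M * R) * (1 + norm x)"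
    using pos R by (simp add: algebra_simps)
  finally have n: "\<bar>l1 (fst p \<bullet> x)\<bar> \<le> (\<bar>l1 0\<bar> + M * R) * (1 + norm x)" .
  have "\<bar>gam p x\<bar> \<le> \<bar>l1 (fst p \<bullet> x)\<bar> / snd p" using gam_upper r by simp
  also have "\<dots> \<le> ((\<bar>l1 0\<bar> + M * R) * (1 + norm x)) / m"
    using n r m by (intro frac_le) auto
  finally show ?thesis by (simp add: c1_def)
qed

lemma Qb_reg:
  assumes p: "p \<in> reg m R" shows "norm (Q x (fst p)) \<le> cu * R"
  using Q_upper[of x "fst p"] mult_left_mono[OF reg_norm(5)[OF p], of cu] pos by linarith

text \<open>One estimate for two vectors: \<open>c = 2\<close> gives \<open>y p x\<close>,
  \<open>c = 1\<close> the vector occurring in \<open>grad\<close>.\<close>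

lemma shift_reg:
  assumes p: "p \<in> reg m R" and c: "\<bar>c\<bar> \<le> 2"
  shows "norm (x + (c * gam p x * s) *\<^sub>R Q x (fst p)) \<le> c2 * (1 + norm x)"
proof -
  have "norm (x + (c * gam p x * s) *\<^sub>R Q x (fst p)) \<le> norm x + \<bar>c\<bar> * \<bar>gam p x\<bar> * s * norm (Q x (fst p))"
    using pos by (intro order.trans[OF norm_triangle_ineq]) (simp add: abs_mult)
  also have "\<dots> \<le> norm x + 2 * (c1 * (1 + norm x)) * s * (cu * R)"
    using gam_reg[OF p, of x] Qb_reg[OF p, of x] c pos c_nonneg R
    by (intro add_left_mono mult_mono) auto
  also have "\<dots> \<le> c2 * (1 + norm x)"
    using pos R c_nonneg by (simp add: c2_def algebra_simps)
  finally show ?thesis .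
qed

lemma y_reg: "p \<in> reg m R \<Longrightarrow> norm (y p x) \<le> c2 * (1 + norm x)"
  unfolding y_def by (rule shift_reg) auto

lemma dgam_reg:
  assumes p: "p \<in> reg m R" shows "\<bar>dgam p x h\<bar> \<le> c3 * (1 + norm x) * norm h"
proof -
  note r = reg_norm[OF p]
  have "\<bar>y p x \<bullet> fst h\<bar> \<le> norm (y p x) * norm (fst h)" by (rule Cauchy_Schwarz_ineq2)
  also have "\<dots> \<le> (c2 * (1 + norm x)) * norm h"
    using y_reg[OF p] norm_fst_le[of "fst h" "snd h"] c_nonneg by (intro mult_mono) auto
  finally have "\<bar>l2 (u p x)\<bar> * \<bar>y p x \<bullet> fst h\<bar> \<le> M * ((c2 * (1 + norm x)) * norm h)"
    using l2_bounds[of "u p x"] pos by (intro mult_mono) auto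
  moreover have "\<bar>gam p x\<bar> * \<bar>snd h\<bar> \<le> (c1 * (1 + norm x)) * norm h"
    using gam_reg[OF p] norm_snd_le[of "snd h" "fst h"] c_nonneg by (intro mult_mono) auto
  moreover have "\<bar>l2 (u p x) * (y p x \<bullet> fst h) - 2 * gam p x * snd h\<bar>
      \<le> \<bar>l2 (u p x)\<bar> * \<bar>y p x \<bullet> fst h\<bar> + 2 * (\<bar>gam p x\<bar> * \<bar>snd h\<bar>)"
    by (rule order.trans[OF abs_triangle_ineq4]) (simp add: abs_mult)
  ultimately have n: "\<bar>l2 (u p x) * (y p x \<bullet> fst h) - 2 * gam p x * snd h\<bar>
      \<le> (M * c2 + 2 * c1) * (1 + norm x) * norm h"
    by (simp add: algebra_simps)
  have "\<bar>dgam p x h\<bar> = \<bar>l2 (u p x) * (y p x \<bullet> fst h) - 2 * gam p x * snd h\<bar> / den p x"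
    using den_lower[OF r(1), of x] r by (simp add: dgam_def)
  also have "\<dots> \<le> ((M * c2 + 2 * c1) * (1 + norm x) * norm h) / m"
    using n m r den_lower[OF r(1), of x] by (intro frac_le) auto
  finally show ?thesis by (simp add: c3_def)
qed

lemma u_reg:
  assumes p: "p \<in> reg m R" shows "\<bar>u p x\<bar> \<le> c5 * (1 + norm x)"
proof -
  have "\<bar>u p x\<bar> \<le> \<bar>fst p \<bullet> x\<bar> + \<bar>gam p x\<bar> * s * \<bar>q p x\<bar>"
    unfolding u_def shifted_def using pos
    by (intro order.trans[OF abs_triangle_ineq]) (simp add: abs_mult)
  also have "\<dots> \<le> R * (1 + norm x) + (c1 * (1 + norm x)) * s * c4"
  proof (intro add_mono mult_mono)
    show "\<bar>fst p \<bullet> x\<bar> \<le> R * (1 + norm x)"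
      using Cauchy_Schwarz_ineq2[of "fst p" x] mult_mono[of "norm (fst p)" R "norm x" "1 + norm x"]
        reg_norm[OF p] R by auto
  qed (use gam_reg[OF p] q_reg[OF p] pos c_nonneg in auto)
  finally show ?thesis by (simp add: c5_def algebra_simps)
qed

text \<open>Counting powers: every summand contains at most two factors of linear growth in
  \<open>x\<close>, the others being bounded. Lower powers are absorbed because
  \<open>1 + norm x\<close> is at least 1.\<close>

lemma reg_bounds:
  obtains K where "0 \<le> K"
    "\<And>p x. p \<in> reg m R \<Longrightarrow> \<bar>dual_value p x\<bar> \<le> K * (1 + norm x)\<^sup>2"
    "\<And>p x. p \<in> reg m R \<Longrightarrow> norm (grad p x) \<le> K * (1 + norm x)\<^sup>2"
    "\<And>p x h. p \<in> reg m R \<Longrightarrow> norm (hess p x h) \<le> K * (1 + norm x)\<^sup>2 * norm h"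
proof
  \<comment> \<open>\<open>k0\<close>, \<open>k1\<close>, \<open>k2\<close> collect the bounds for
    the value, the gradient and the Hessian; their sum serves all three.\<close>
  define k0 where "k0 = \<bar>l 0\<bar> + \<bar>l1 0\<bar> * c5 + M / 2 * (c5 * c5) + R * s * (c1 * c1 * c4 + 1)"
  define k1 where "k1 = 2 * R * c1 * c2 + s * (1 + c1 * c1 * c4)"
  define k2 where "k2 = (2 * R * c3 * c2 + 2 * c1 * c2 + 2 * R * s * (c1 * c1) * cu)
      + s * (2 * c1 * c3 * c4 + 2 * (c1 * c1) * (cu * R))"
  have k: "0 \<le> k0" "0 \<le> k1" "0 \<le> k2"
    unfolding k0_def k1_def k2_def using c_nonneg pos R by (auto intro!: add_nonneg_nonneg)
  show "0 \<le> k0 + k1 + k2" using k by simp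
  fix p :: "'a \<times> real" and x :: 'a assume p: "p \<in> reg m R"
  note r = reg_norm[OF p]
  define W where "W = 1 + norm x"
  have W: "1 \<le> W" "W \<le> W * W" "1 \<le> W * W" unfolding W_def by (auto simp: algebra_simps)
  have g: "\<bar>gam p x\<bar> \<le> c1 * W" unfolding W_def by (rule gam_reg[OF p])
  have g2: "(gam p x)\<^sup>2 \<le> c1 * c1 * (W * W)"
    using power_mono[OF g, of 2] by (simp add: power2_eq_square ac_simps)
  have qq: "\<bar>q p x\<bar> \<le> c4" by (rule q_reg[OF p])
  have y1: "norm (x + (s * gam p x) *\<^sub>R Q x (fst p)) \<le> c2 * W"
    using shift_reg[OF p, of 1 x] by (simp add: W_def mult.commute)
  have g2q: "\<bar>(gam p x)\<^sup>2 * q p x\<bar> \<le> c1 * c1 * (W * W) * c4"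
    unfolding abs_mult using g2 qq c_nonneg W by (intro mult_mono) auto
  show "\<bar>dual_value p x\<bar> \<le> (k0 + k1 + k2) * (1 + norm x)\<^sup>2"
  proof -
    have uu: "\<bar>u p x\<bar> \<le> c5 * W" unfolding W_def by (rule u_reg[OF p])
    have u2: "(u p x)\<^sup>2 \<le> c5 * c5 * (W * W)"
      using power_mono[OF uu, of 2] by (simp add: power2_eq_square ac_simps)
    have "\<bar>l (u p x)\<bar> \<le> \<bar>l 0\<bar> + \<bar>l1 0\<bar> * \<bar>u p x\<bar> + M / 2 * (u p x)\<^sup>2" by (rule l_growth)
    also have "\<dots> \<le> \<bar>l 0\<bar> * (W * W) + \<bar>l1 0\<bar> * (c5 * (W * W)) + M / 2 * (c5 * c5 * (W * W))"
    proof (intro add_mono mult_left_mono u2)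
      show "\<bar>l 0\<bar> \<le> \<bar>l 0\<bar> * (W * W)" using mult_left_mono[OF W(3), of "\<bar>l 0\<bar>"] by simp
      show "\<bar>u p x\<bar> \<le> c5 * (W * W)" using uu mult_left_mono[OF W(2), of c5] c_nonneg by simp
    qed (use pos in auto)
    finally have 1: "\<bar>l (u p x)\<bar> \<le> (\<bar>l 0\<bar> + \<bar>l1 0\<bar> * c5 + M / 2 * (c5 * c5)) * (W * W)"
      by (simp add: algebra_simps)
    have "\<bar>snd p * s * ((gam p x)\<^sup>2 * q p x - 1)\<bar> \<le> R * s * (c1 * c1 * (W * W) * c4 + W * W)"
      unfolding abs_mult[of "snd p * s"] abs_mult[of "snd p"]
      using r pos R W g2q by (intro mult_mono) (auto intro!: mult_nonneg_nonneg)
    also have "\<dots> = R * s * (c1 * c1 * c4 + 1) * (W * W)" by (simp add: algebra_simps)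
    finally have 2: "\<bar>snd p * s * ((gam p x)\<^sup>2 * q p x - 1)\<bar> \<le> R * s * (c1 * c1 * c4 + 1) * (W * W)" .
    have "\<bar>dual_value p x\<bar> \<le> k0 * (W * W)"
      using 1 2 unfolding dual_value_def k0_def distrib_right by linarith
    also have "\<dots> \<le> (k0 + k1 + k2) * (W * W)" using k W by (intro mult_right_mono) auto
    finally show ?thesis by (simp add: W_def power2_eq_square)
  qed
  show "norm (grad p x) \<le> (k0 + k1 + k2) * (1 + norm x)\<^sup>2"
  proof -
    have "norm (fst (grad p x)) = 2 * \<bar>snd p\<bar> * \<bar>gam p x\<bar> * norm (x + (s * gam p x) *\<^sub>R Q x (fst p))"
      by (simp add: grad_def abs_mult)
    also have "\<dots> \<le> 2 * R * (c1 * W) * (c2 * W)"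
      using r R c_nonneg g y1 W by (intro mult_mono) auto
    finally have 1: "norm (fst (grad p x)) \<le> 2 * R * c1 * c2 * (W * W)" by (simp add: ac_simps)
    have "norm (snd (grad p x)) = s * \<bar>1 - (gam p x)\<^sup>2 * q p x\<bar>"
      using pos by (simp add: grad_def abs_mult)
    also have "\<dots> \<le> s * (W * W + c1 * c1 * (W * W) * c4)"
      using pos W g2q by (intro mult_left_mono) auto
    finally have 2: "norm (snd (grad p x)) \<le> s * (1 + c1 * c1 * c4) * (W * W)"
      by (simp add: algebra_simps)
    have "norm (grad p x) \<le> norm (fst (grad p x)) + norm (snd (grad p x))"
      using norm_Pair_le[of "fst (grad p x)" "snd (grad p x)"] by simp
    also have "\<dots> \<le> k1 * (W * W)" using 1 2 unfolding k1_def distrib_right by linarith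
    also have "\<dots> \<le> (k0 + k1 + k2) * (W * W)" using k W by (intro mult_right_mono) auto
    finally show ?thesis by (simp add: W_def power2_eq_square)
  qed
  fix h :: "'a \<times> real"
  have dg: "\<bar>dgam p x h\<bar> \<le> c3 * W * norm h" unfolding W_def by (rule dgam_reg[OF p])
  have yy: "norm (y p x) \<le> c2 * W" unfolding W_def by (rule y_reg[OF p])
  have fh: "norm (fst h) \<le> norm h" "\<bar>snd h\<bar> \<le> norm h"
    using norm_fst_le[of "fst h" "snd h"] norm_snd_le[of "snd h" "fst h"] by auto
  show "norm (hess p x h) \<le> (k0 + k1 + k2) * (1 + norm x)\<^sup>2 * norm h"
  proof -
    have "norm ((2 * snd p * dgam p x h) *\<^sub>R y p x) = 2 * \<bar>snd p\<bar> * \<bar>dgam p x h\<bar> * norm (y p x)"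
      by (simp add: abs_mult)
    also have "\<dots> \<le> 2 * R * (c3 * W * norm h) * (c2 * W)"
      using r R c_nonneg dg yy W by (intro mult_mono) auto
    finally have 1: "norm ((2 * snd p * dgam p x h) *\<^sub>R y p x) \<le> 2 * R * c3 * c2 * (W * W * norm h)"
      by (simp add: ac_simps)
    have "norm ((2 * snd h * gam p x) *\<^sub>R (x + (s * gam p x) *\<^sub>R Q x (fst p)))
        = 2 * \<bar>snd h\<bar> * \<bar>gam p x\<bar> * norm (x + (s * gam p x) *\<^sub>R Q x (fst p))"
      by (simp add: abs_mult)
    also have "\<dots> \<le> 2 * norm h * (c1 * W) * (c2 * W)"
      using c_nonneg g y1 W fh by (intro mult_mono) auto
    finally have 2: "norm ((2 * snd h * gam p x) *\<^sub>R (x + (s * gam p x) *\<^sub>R Q x (fst p)))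
        \<le> 2 * c1 * c2 * (W * W * norm h)" by (simp add: ac_simps)
    have "norm ((2 * snd p * s * (gam p x)\<^sup>2) *\<^sub>R Q x (fst h)) = 2 * \<bar>snd p\<bar> * s * (gam p x)\<^sup>2 * norm (Q x (fst h))"
      using pos by (simp add: abs_mult)
    also have "\<dots> \<le> 2 * R * s * (c1 * c1 * (W * W)) * (cu * norm h)"
      using r R c_nonneg g2 W pos order.trans[OF Q_upper mult_left_mono[OF fh(1), of cu]]
      by (intro mult_mono) auto
    finally have 3: "norm ((2 * snd p * s * (gam p x)\<^sup>2) *\<^sub>R Q x (fst h))
        \<le> 2 * R * s * (c1 * c1) * cu * (W * W * norm h)" by (simp add: ac_simps)
    have "norm (fst (hess p x h)) \<le> norm ((2 * snd p * dgam p x h) *\<^sub>R y p x)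
        + norm ((2 * snd h * gam p x) *\<^sub>R (x + (s * gam p x) *\<^sub>R Q x (fst p)))
        + norm ((2 * snd p * s * (gam p x)\<^sup>2) *\<^sub>R Q x (fst h))"
      unfolding hess_def fst_conv by (rule order.trans[OF norm_triangle_ineq add_right_mono[OF norm_triangle_ineq]])
    then have f: "norm (fst (hess p x h))
        \<le> (2 * R * c3 * c2 + 2 * c1 * c2 + 2 * R * s * (c1 * c1) * cu) * (W * W * norm h)"
      using 1 2 3 unfolding distrib_right by linarith
    have "\<bar>2 * gam p x * dgam p x h * q p x\<bar> \<le> 2 * (c1 * W) * (c3 * W * norm h) * c4"
      unfolding abs_mult using g dg qq c_nonneg W by (intro mult_mono) auto
    moreover have "\<bar>Q x (fst p) \<bullet> fst h\<bar> \<le> (cu * R) * norm h"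
      by (rule order.trans[OF Cauchy_Schwarz_ineq2])
         (use Qb_reg[OF p, of x] fh pos R in \<open>intro mult_mono; auto\<close>)
    then have "\<bar>2 * (gam p x)\<^sup>2 * (Q x (fst p) \<bullet> fst h)\<bar> \<le> 2 * (c1 * c1 * (W * W)) * ((cu * R) * norm h)"
      unfolding abs_mult using g2 c_nonneg W by (intro mult_mono) auto
    ultimately have "\<bar>2 * gam p x * dgam p x h * q p x + 2 * (gam p x)\<^sup>2 * (Q x (fst p) \<bullet> fst h)\<bar>
        \<le> 2 * (c1 * W) * (c3 * W * norm h) * c4 + 2 * (c1 * c1 * (W * W)) * ((cu * R) * norm h)"
      by linarith
    also have "\<dots> = (2 * c1 * c3 * c4 + 2 * (c1 * c1) * (cu * R)) * (W * W * norm h)"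
      by (simp add: algebra_simps)
    finally have "norm (snd (hess p x h)) \<le> s * ((2 * c1 * c3 * c4 + 2 * (c1 * c1) * (cu * R)) * (W * W * norm h))"
      using pos by (simp add: hess_def abs_mult)
    then have "norm (fst (hess p x h)) + norm (snd (hess p x h)) \<le> k2 * (W * W * norm h)"
      using f unfolding k2_def distrib_right[of _ _ "W * W * norm h"] mult.assoc[of s] by linarith
    moreover have "norm (hess p x h) \<le> norm (fst (hess p x h)) + norm (snd (hess p x h))"
      using norm_Pair_le[of "fst (hess p x h)" "snd (hess p x h)"] by simp
    moreover have "k2 * (W * W * norm h) \<le> (k0 + k1 + k2) * (W * W * norm h)"
      using k W by (intro mult_right_mono) auto
    ultimately show ?thesis by (simp add: W_def power2_eq_square mult.assoc)
  qed
qed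

end

end

subsection \<open>Differentiation under the expectation\<close>

context robust_dual begin

lemma measurable_P: "f \<in> borel_measurable borel \<Longrightarrow> f \<in> borel_measurable P"
  using measurable_cong_sets[OF P(2) refl] by blast

lemma weight_integrable: "integrable P (\<lambda>x. (1 + norm x)\<^sup>2)"
proof (rule Bochner_Integration.integrable_bound)
  interpret prob_space P by (rule P)
  show "integrable P (\<lambda>x. 2 + 2 * (norm x)\<^sup>2)" using P(3) by simp
  have "(1 + norm x)\<^sup>2 \<le> 2 + 2 * (norm x)\<^sup>2" for x :: 'a
    using sum_squares_ge_zero[of "1 - norm x" 0] by (simp add: power2_eq_square algebra_simps)
  then show "AE x in P. norm ((1 + norm x)\<^sup>2) \<le> norm (2 + 2 * (norm x)\<^sup>2)" by simp
  show "(\<lambda>x. (1 + norm x)\<^sup>2) \<in> borel_measurable P" by (rule measurable_P) measurable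
qed

context
  fixes p assumes p: "p \<in> dom"
begin

lemma gam_measurable' [measurable]: "gam p \<in> borel_measurable borel"
  by (rule gam_measurable[OF p])

lemma u_measurable [measurable]: "u p \<in> borel_measurable borel"
  unfolding u_def shifted_def by measurable

lemma y_measurable [measurable]: "y p \<in> borel_measurable borel"
  unfolding y_def by measurable

lemma den_measurable [measurable]: "den p \<in> borel_measurable borel"
  unfolding den_def by measurable

lemma dgam_measurable [measurable]: "(\<lambda>x. dgam p x h) \<in> borel_measurable borel"
  unfolding dgam_def by measurable

lemma dual_value_measurable: "dual_value p \<in> borel_measurable P"
  unfolding dual_value_def by (rule measurable_P) measurable

lemma grad_measurable: "grad p \<in> borel_measurable P"
  unfolding grad_def by (rule measurable_P) measurable

lemma hess_measurable: "(\<lambda>x. hess p x h) \<in> borel_measurable P"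
  unfolding hess_def by (rule measurable_P) measurable

end

definition dual_integral :: "'a \<times> real \<Rightarrow> real" where
  "dual_integral p = (\<integral>x. dual_value p x \<partial>P)"

definition Hess :: "'a \<times> real \<Rightarrow> 'a \<times> real \<Rightarrow> 'a \<times> real" where
  "Hess p h = (\<integral>x. hess p x h \<partial>P)"

text \<open>On a small ball \<open>snd\<close> stays above half its value at \<open>p\<close>, so
  one multiple of \<open>(1 + norm x)\<^sup>2\<close> dominates all integrands near
  \<open>p\<close>.\<close>

lemma dom_reg_ball:
  assumes p: "p \<in> dom"
  obtains e m R where "0 < e" "0 < m" "0 \<le> R" "ball p e \<subseteq> reg m R"
proof -
  have "open (dom \<inter> {p'. snd p / 2 < snd p'})"
    by (intro open_Int open_dom open_Collect_less continuous_intros)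
  moreover have "p \<in> dom \<inter> {p'. snd p / 2 < snd p'}" using p dom_pos[OF p] by simp
  ultimately obtain e where e: "0 < e" "ball p e \<subseteq> dom \<inter> {p'. snd p / 2 < snd p'}"
    by (meson open_contains_ball)
  have "norm p' \<le> norm p + e" if "p' \<in> ball p e" for p'
    using that norm_triangle_sub[of p' p] by (simp add: dist_norm norm_minus_commute)
  with e have "ball p e \<subseteq> reg (snd p / 2) (norm p + e)" unfolding reg_def by fastforce
  with e(1) dom_pos[OF p] show thesis by (intro that[of e "snd p / 2" "norm p + e"]) auto
qed

lemma integrals:
  assumes p: "p \<in> dom"
  shows "integrable P (dual_value p)" "integrable P (grad p)" "integrable P (\<lambda>x. hess p x h)"
    and "(dual_integral has_derivative (\<lambda>h. (\<integral>x. grad p x \<partial>P) \<bullet> h)) (at p)"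
    and "((\<lambda>p. \<integral>x. grad p x \<partial>P) has_derivative Hess p) (at p)"
proof -
  obtain e m R where e: "0 < e" "0 < m" "0 \<le> R" "ball p e \<subseteq> reg m R"
    using dom_reg_ball[OF p] by blast
  obtain K where K: "0 \<le> K"
    "\<And>p x. p \<in> reg m R \<Longrightarrow> \<bar>dual_value p x\<bar> \<le> K * (1 + norm x)\<^sup>2"
    "\<And>p x. p \<in> reg m R \<Longrightarrow> norm (grad p x) \<le> K * (1 + norm x)\<^sup>2"
    "\<And>p x h. p \<in> reg m R \<Longrightarrow> norm (hess p x h) \<le> K * (1 + norm x)\<^sup>2 * norm h"
    using reg_bounds[OF e(2,3)] by blast
  have Kint: "integrable P (\<lambda>x. K * (1 + norm x)\<^sup>2)"
    using weight_integrable by simp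
  have S: "convex (ball p e)" "open (ball p e)" "p \<in> ball p e" using e(1) by auto
  have sub: "p' \<in> dom" "p' \<in> reg m R" if "p' \<in> ball p e" for p'
    using e(4) that unfolding reg_def by auto
  show dv: "integrable P (dual_value p)"
    by (rule Bochner_Integration.integrable_bound[OF Kint dual_value_measurable[OF p]])
       (use K sub S in auto)
  show g: "integrable P (grad p)"
    by (rule Bochner_Integration.integrable_bound[OF Kint grad_measurable[OF p]])
       (use K sub S in auto)
  show "integrable P (\<lambda>x. hess p x h)"
    by (rule has_derivative_integral(2)[where G=grad and D=hess and K="\<lambda>x. K * (1 + norm x)\<^sup>2",
      OF S grad_deriv K(4) Kint grad_measurable hess_measurable g]) (use sub p in auto)
  show "((\<lambda>p. \<integral>x. grad p x \<partial>P) has_derivative Hess p) (at p)"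
    unfolding Hess_def[abs_def]
    by (rule has_derivative_integral(3)[where G=grad and D=hess and K="\<lambda>x. K * (1 + norm x)\<^sup>2",
      OF S grad_deriv K(4) Kint grad_measurable hess_measurable g]) (use sub p in auto)
  have "(dual_integral has_derivative (\<lambda>h. \<integral>x. grad p x \<bullet> h \<partial>P)) (at p)"
    unfolding dual_integral_def[abs_def]
  proof (rule has_derivative_integral(3)[where G=dual_value and D="\<lambda>p x h. grad p x \<bullet> h"
        and K="\<lambda>x. K * (1 + norm x)\<^sup>2", OF S dual_value_deriv _ Kint dual_value_measurable _ dv])
    show "norm (grad p' x \<bullet> h) \<le> K * (1 + norm x)\<^sup>2 * norm h" if "p' \<in> ball p e" for p' x h
      using order.trans[OF Cauchy_Schwarz_ineq2 mult_right_mono[OF K(3)[OF sub(2)[OF that]]], of h x] by simp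
    show "(\<lambda>x. grad p x \<bullet> h) \<in> borel_measurable P" for h
      using grad_measurable[OF p] by measurable
  qed (use sub p in auto)
  then show "(dual_integral has_derivative (\<lambda>h. (\<integral>x. grad p x \<partial>P) \<bullet> h)) (at p)"
    using g by simp
qed

text \<open>A Hessian presupposes a gradient on a full neighbourhood; openness of \<open>dom\<close>
  provides it, whether or not the neighbouring points lie over \<open>B\<close>.\<close>

lemma has_hessian_dual_integral:
  assumes p: "p \<in> dom" and f: "\<And>p. p \<in> dom \<Longrightarrow> f p = ereal (dual_integral p)"
  shows "has_hessian f (Hess p) p"
  unfolding has_hessian_def
proof (intro exI conjI)
  have "\<forall>\<^sub>F y in nhds p. y \<in> dom" using open_dom p by (rule eventually_nhds_in_open)
  then show "\<forall>\<^sub>F y in nhds p. \<bar>f y\<bar> \<noteq> \<infinity> \<and>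
     ((\<lambda>w. real_of_ereal (f w)) has_derivative (\<lambda>h. (\<integral>x. grad y x \<partial>P) \<bullet> h)) (at y)"
  proof eventually_elim
    case (elim y)
    have "((\<lambda>w. real_of_ereal (f w)) has_derivative (\<lambda>h. (\<integral>x. grad y x \<partial>P) \<bullet> h)) (at y)"
      by (rule has_derivative_transform_within_open[OF integrals(4)[OF elim] open_dom elim])
         (simp add: f)
    then show ?case using f[OF elim] by simp
  qed
  show "((\<lambda>p. \<integral>x. grad p x \<partial>P) has_derivative Hess p) (at p)" using integrals(5)[OF p] .
qed

lemma onorm_Hess_bound:
  assumes "0 < m" "0 \<le> R"
  obtains C where "\<And>p. p \<in> reg m R \<Longrightarrow> onorm (Hess p) \<le> C"
proof -
  obtain K where K: "0 \<le> K"
    "\<And>p x. p \<in> reg m R \<Longrightarrow> \<bar>dual_value p x\<bar> \<le> K * (1 + norm x)\<^sup>2"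
    "\<And>p x. p \<in> reg m R \<Longrightarrow> norm (grad p x) \<le> K * (1 + norm x)\<^sup>2"
    "\<And>p x h. p \<in> reg m R \<Longrightarrow> norm (hess p x h) \<le> K * (1 + norm x)\<^sup>2 * norm h"
    using reg_bounds[OF assms] by blast
  have "onorm (Hess p) \<le> K * (\<integral>x. (1 + norm x)\<^sup>2 \<partial>P)" if p: "p \<in> reg m R" for p
  proof (rule onorm_le)
    fix h
    have d: "p \<in> dom" using p by (simp add: reg_def)
    have "norm (Hess p h) \<le> (\<integral>x. norm (hess p x h) \<partial>P)"
      unfolding Hess_def by (rule integral_norm_bound)
    also have "\<dots> \<le> (\<integral>x. K * (1 + norm x)\<^sup>2 * norm h \<partial>P)"
      using integrals(3)[OF d] weight_integrable by (intro integral_mono K(4) p) auto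
    finally show "norm (Hess p h) \<le> K * (\<integral>x. (1 + norm x)\<^sup>2 \<partial>P) * norm h" by simp
  qed
  then show thesis by (rule that)
qed

section \<open>The block of the Hessian in \<open>\<beta>\<close>\<close>

lemma Hess_fst_inner:
  assumes p: "p \<in> dom"
  shows "v \<bullet> fst (Hess p (h, 0)) = (\<integral>x. v \<bullet> fst (hess p x (h, 0)) \<partial>P)"
    and "integrable P (\<lambda>x. v \<bullet> fst (hess p x (h, 0)))"
proof -
  have e: "v \<bullet> fst z = (v, 0) \<bullet> z" for z :: "'a \<times> real" by (simp add: inner_prod_def)
  show "v \<bullet> fst (Hess p (h, 0)) = (\<integral>x. v \<bullet> fst (hess p x (h, 0)) \<partial>P)"
    unfolding e Hess_def by (rule integral_inner_right[symmetric]) (rule integrals(3)[OF p])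
  show "integrable P (\<lambda>x. v \<bullet> fst (hess p x (h, 0)))"
    unfolding e by (rule integrable_inner_right) (rule integrals(3)[OF p])
qed

lemma inner_fst_hess:
  "v \<bullet> fst (hess p x (h, 0)) = 2 * snd p * (l2 (u p x) / den p x) * ((y p x \<bullet> h) * (y p x \<bullet> v))
     + 2 * snd p * s * (gam p x)\<^sup>2 * (v \<bullet> Q x h)"
  by (simp add: hess_def dgam_def inner_add_right inner_commute)

text \<open>Both summands of \<open>inner_fst_hess\<close> are symmetric in \<open>v\<close> and
  \<open>h\<close>, and integration preserves this. The order \<open>loewner_ge\<close> demands
  symmetry as well as nonnegativity.\<close>

lemma Hess_fst_sym:
  assumes p: "p \<in> dom"
  shows "v \<bullet> fst (Hess p (h, 0)) = fst (Hess p (v, 0)) \<bullet> h"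
proof -
  have "v \<bullet> fst (hess p x (h, 0)) = h \<bullet> fst (hess p x (v, 0))" for x
    unfolding inner_fst_hess using Q_sym[of v x h] inner_commute[of "Q x v" h] by simp
  then show ?thesis
    using Hess_fst_inner(1)[OF p, of v h] Hess_fst_inner(1)[OF p, of h v]
    by (simp add: inner_commute[of _ h])
qed

text \<open>The rank-one part of the Hessian is positive semidefinite and is dropped; the curvature comes
  from \<^term>\<open>Q\<close>, weighted by \<^term>\<open>(gam p x)\<^sup>2\<close>.\<close>

lemma Hess_fst_lower:
  assumes p: "p \<in> dom" and i: "integrable P (\<lambda>x. (l1 (fst p \<bullet> x))\<^sup>2)"
    and L: "L \<le> (\<integral>x. (l1 (fst p \<bullet> x))\<^sup>2 \<partial>P)"
  shows "s * cl * L / (2 * snd p) * (norm h)\<^sup>2 \<le> h \<bullet> fst (Hess p (h, 0))"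
proof -
  have t: "0 < snd p" using dom_pos[OF p] .
  \<comment> \<open>Chosen so that the factor \<open>(2 * snd p)\<^sup>2\<close> from
    \<open>gam_lower\<close> turns it into the coefficient \<open>2 * snd p * s * cl\<close> of the
    \<open>Q\<close> term.\<close>
  let ?c = "s * cl / (2 * snd p) * (norm h)\<^sup>2"
  have c: "0 \<le> ?c" using t pos by simp
  have pt: "?c * (l1 (fst p \<bullet> x))\<^sup>2 \<le> h \<bullet> fst (hess p x (h, 0))" for x
  proof -
    have "(l1 (fst p \<bullet> x))\<^sup>2 \<le> (2 * snd p)\<^sup>2 * (gam p x)\<^sup>2"
      using power_mono[OF gam_lower[OF p, of x], of 2] by (simp add: power_mult_distrib)
    then have "?c * (l1 (fst p \<bullet> x))\<^sup>2 \<le> ?c * ((2 * snd p)\<^sup>2 * (gam p x)\<^sup>2)"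
      using c by (rule mult_left_mono)
    also have "\<dots> = 2 * snd p * s * (gam p x)\<^sup>2 * (cl * (norm h)\<^sup>2)"
      using t by (simp add: field_simps power2_eq_square)
    also have "\<dots> \<le> 2 * snd p * s * (gam p x)\<^sup>2 * (h \<bullet> Q x h)"
      using t pos by (intro mult_left_mono Q_lower) auto
    also have "\<dots> \<le> h \<bullet> fst (hess p x (h, 0))"
      unfolding inner_fst_hess using t l2_bounds[of "u p x"] den_lower[OF p, of x] by simp
    finally show ?thesis .
  qed
  have "s * cl * L / (2 * snd p) * (norm h)\<^sup>2 = ?c * L" by simp
  also have "\<dots> \<le> ?c * (\<integral>x. (l1 (fst p \<bullet> x))\<^sup>2 \<partial>P)" using L c by (rule mult_left_mono)
  also have "\<dots> = (\<integral>x. ?c * (l1 (fst p \<bullet> x))\<^sup>2 \<partial>P)" by simp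
  also have "\<dots> \<le> (\<integral>x. h \<bullet> fst (hess p x (h, 0)) \<partial>P)"
    using i Hess_fst_inner(2)[OF p] by (intro integral_mono pt) auto
  finally show ?thesis using Hess_fst_inner(1)[OF p] by simp
qed

section \<open>Second moments of the derivative of the loss\<close>

lemma l1_square_bound:
  assumes "norm b \<le> R"
  shows "(l1 (b \<bullet> x))\<^sup>2 \<le> (\<bar>l1 0\<bar> + M * R)\<^sup>2 * (1 + norm x)\<^sup>2"
proof -
  have R: "0 \<le> R" using assms norm_ge_zero order.trans by blast
  have "\<bar>b \<bullet> x\<bar> \<le> R * norm x"
    using Cauchy_Schwarz_ineq2[of b x] mult_right_mono[OF assms, of "norm x"] by simp
  then have "\<bar>l1 (b \<bullet> x)\<bar> \<le> \<bar>l1 0\<bar> + M * (R * norm x)"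
    using l1_growth[of "b \<bullet> x"] mult_left_mono[of "\<bar>b \<bullet> x\<bar>" "R * norm x" M] pos by linarith
  also have "\<dots> \<le> (\<bar>l1 0\<bar> + M * R) * (1 + norm x)"
    using pos R by (simp add: algebra_simps)
  finally show ?thesis
    using power_mono[of "\<bar>l1 (b \<bullet> x)\<bar>" "(\<bar>l1 0\<bar> + M * R) * (1 + norm x)" 2]
    by (simp add: power_mult_distrib)
qed

lemma l1_square_measurable: "(\<lambda>x. (l1 (b \<bullet> x))\<^sup>2) \<in> borel_measurable P"
  by (rule measurable_P) measurable

lemma l1_square_integrable: "integrable P (\<lambda>x. (l1 (b \<bullet> x))\<^sup>2)"
proof (rule Bochner_Integration.integrable_bound)
  show "integrable P (\<lambda>x. (\<bar>l1 0\<bar> + M * norm b)\<^sup>2 * (1 + norm x)\<^sup>2)"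
    using weight_integrable by simp
qed (use l1_square_measurable l1_square_bound[of b "norm b"] in auto)

lemma l1_square_continuous:
  assumes "bounded B"
  shows "continuous_on B (\<lambda>b. \<integral>x. (l1 (b \<bullet> x))\<^sup>2 \<partial>P)"
  unfolding continuous_on_sequentially
proof (intro allI ballI impI)
  obtain R where R: "\<And>b. b \<in> B \<Longrightarrow> norm b \<le> R" using assms by (auto simp: bounded_iff)
  fix X a assume a: "a \<in> B" and X: "(\<forall>n. X n \<in> B) \<and> X \<longlonglongrightarrow> a"
  have "(\<lambda>n. \<integral>x. (l1 (X n \<bullet> x))\<^sup>2 \<partial>P) \<longlonglongrightarrow> (\<integral>x. (l1 (a \<bullet> x))\<^sup>2 \<partial>P)"
  proof (rule integral_dominated_convergence)
    show "integrable P (\<lambda>x. (\<bar>l1 0\<bar> + M * R)\<^sup>2 * (1 + norm x)\<^sup>2)"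
      using weight_integrable by simp
    have "isCont l1 z" for z using l1_deriv DERIV_isCont by blast
    then have "(\<lambda>n. (l1 (X n \<bullet> x))\<^sup>2) \<longlonglongrightarrow> (l1 (a \<bullet> x))\<^sup>2" for x
      using X by (intro tendsto_power isCont_tendsto_compose[of _ l1] tendsto_inner tendsto_const) auto
    then show "AE x in P. (\<lambda>n. (l1 (X n \<bullet> x))\<^sup>2) \<longlonglongrightarrow> (l1 (a \<bullet> x))\<^sup>2" by simp
    show "AE x in P. norm ((l1 (X n \<bullet> x))\<^sup>2) \<le> (\<bar>l1 0\<bar> + M * R)\<^sup>2 * (1 + norm x)\<^sup>2" for n
      using l1_square_bound[OF R, of "X n"] X by simp
  qed (rule l1_square_measurable)+
  then show "((\<lambda>b. \<integral>x. (l1 (b \<bullet> x))\<^sup>2 \<partial>P) \<circ> X) \<longlonglongrightarrow> (\<integral>x. (l1 (a \<bullet> x))\<^sup>2 \<partial>P)"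
    by (simp add: comp_def)
qed

text \<open>The second moment is continuous in \<open>b\<close>, so it attains its extrema on the
  compact set \<open>B\<close>. A zero minimum would make \<open>l1 (b0 \<bullet> x)\<close> vanish
  almost surely, against \<open>nz\<close>.\<close>

lemma l1_square_moment_bounds:
  assumes B: "compact B" "B \<noteq> {}"
    and nz: "\<And>b. b \<in> B \<Longrightarrow> 0 < measure P {x \<in> space P. l1 (b \<bullet> x) \<noteq> 0}"
  obtains L U where "0 < L" "0 < U"
    "\<And>b. b \<in> B \<Longrightarrow> L \<le> (\<integral>x. (l1 (b \<bullet> x))\<^sup>2 \<partial>P)"
    "\<And>b. b \<in> B \<Longrightarrow> (\<integral>x. (l1 (b \<bullet> x))\<^sup>2 \<partial>P) \<le> U"
proof -
  let ?I = "\<lambda>b. \<integral>x. (l1 (b \<bullet> x))\<^sup>2 \<partial>P"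
  have cont: "continuous_on B ?I"
    by (rule l1_square_continuous) (rule compact_imp_bounded[OF B(1)])
  obtain b0 where b0: "b0 \<in> B" "\<And>b. b \<in> B \<Longrightarrow> ?I b0 \<le> ?I b"
    using continuous_attains_inf[OF B cont] by blast
  obtain b1 where b1: "b1 \<in> B" "\<And>b. b \<in> B \<Longrightarrow> ?I b \<le> ?I b1"
    using continuous_attains_sup[OF B cont] by blast
  have "?I b0 \<noteq> 0"
  proof
    assume "?I b0 = 0"
    then have "AE x in P. (l1 (b0 \<bullet> x))\<^sup>2 = 0"
      using integral_nonneg_eq_0_iff_AE[OF l1_square_integrable[of b0]] by simp
    then have "AE x in P. \<not> l1 (b0 \<bullet> x) \<noteq> 0" by simp
    moreover have "(\<lambda>x. l1 (b0 \<bullet> x)) \<in> borel_measurable P"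
      by (rule measurable_P) measurable
    then have "{x \<in> space P. l1 (b0 \<bullet> x) \<noteq> 0} \<in> sets P" by measurable
    ultimately have "emeasure P {x \<in> space P. l1 (b0 \<bullet> x) \<noteq> 0} = 0"
      using AE_iff_measurable[of "{x \<in> space P. l1 (b0 \<bullet> x) \<noteq> 0}" P "\<lambda>x. \<not> l1 (b0 \<bullet> x) \<noteq> 0"] by simp
    then have "measure P {x \<in> space P. l1 (b0 \<bullet> x) \<noteq> 0} = 0"
      by (simp add: measure_def)
    with nz[OF b0(1)] show False by simp
  qed
  moreover have "0 \<le> ?I b0" by simp
  ultimately have "0 < ?I b0" by linarith
  then show thesis using b0 b1 by (intro that[of "?I b0" "?I b1"]) (auto intro: less_le_trans)
qed

end

subsection \<open>Inverses of positive definite matrices\<close>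

lemma matrix_inv_mult:
  fixes S :: "real^'n^'n"
  assumes "invertible S" shows "S ** matrix_inv S = mat 1"
  using assms unfolding invertible_def matrix_inv_def by (metis (mono_tags, lifting) someI_ex)

lemma positive_definite_invertible:
  assumes "positive_definite S" shows "invertible S"
proof -
  have "v = 0" if "S *v v = 0" for v
  proof (rule ccontr)
    assume "v \<noteq> 0"
    then have "0 < v \<bullet> (S *v v)" using assms by (simp add: positive_definite_def)
    then show False using that by simp
  qed
  then show ?thesis
    unfolding invertible_left_inverse matrix_left_invertible_ker by blast
qed

lemma transpose_eq_iff_selfadjoint:
  fixes S :: "real^'n^'n"
  shows "transpose S = S \<longleftrightarrow> (\<forall>v w. v \<bullet> (S *v w) = (S *v v) \<bullet> w)"
proof -
  have *: "(transpose S *v v) \<bullet> w = v \<bullet> (S *v w)" for v w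
    by (simp add: dot_lmul_matrix)
  show ?thesis
  proof
    assume "transpose S = S"
    then show "\<forall>v w. v \<bullet> (S *v w) = (S *v v) \<bullet> w" using * by simp
  next
    assume "\<forall>v w. v \<bullet> (S *v w) = (S *v v) \<bullet> w"
    then have "transpose S *v v = S *v v" for v
      using * vector_eq_rdot by metis
    then show "transpose S = S" by (simp add: matrix_eq)
  qed
qed

text \<open>Quadratic forms replace diagonalisation. With \<open>z\<close> the image of
  \<open>v\<close> under the inverse,
  \<open>r |z|^2 \<le> z \<bullet> S z = z \<bullet> v \<le> |z| |v|\<close> gives the norm
  bound.\<close>

lemma positive_definite_inverse_bounds:
  fixes S :: "real^'n^'n"
  assumes S: "positive_definite S" and r: "0 < r" "0 < r'"
    and b: "\<And>v. norm v = 1 \<Longrightarrow> r \<le> v \<bullet> (S *v v) \<and> v \<bullet> (S *v v) \<le> r'"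
  shows "v \<bullet> (matrix_inv S *v w) = (matrix_inv S *v v) \<bullet> w"
    and "inverse r' * (norm v)\<^sup>2 \<le> v \<bullet> (matrix_inv S *v v)"
    and "norm (matrix_inv S *v v) \<le> inverse r * norm v"
proof -
  have inv: "S *v (matrix_inv S *v v) = v" for v
    by (simp add: matrix_vector_mul_assoc matrix_inv_mult positive_definite_invertible S)
  have sym: "v \<bullet> (S *v w) = (S *v v) \<bullet> w" for v w
    using S transpose_eq_iff_selfadjoint by (auto simp: positive_definite_def)
  have bb: "r * (norm v)\<^sup>2 \<le> v \<bullet> (S *v v)" "v \<bullet> (S *v v) \<le> r' * (norm v)\<^sup>2" for v
  proof -
    \<comment> \<open>For \<open>v = 0\<close> this is 0, since \<open>inverse 0 = 0\<close>, and
      the bounds are then trivial.\<close>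
    define e where "e = inverse (norm v) *\<^sub>R v"
    have v: "v = norm v *\<^sub>R e" by (cases "v = 0") (auto simp: e_def)
    have "v \<bullet> (S *v v) = (norm v)\<^sup>2 * (e \<bullet> (S *v e))"
      by (subst (1 2) v) (simp add: matrix_vector_mult_scaleR power2_eq_square)
    moreover have "norm v = 0 \<or> norm e = 1" by (cases "v = 0") (auto simp: e_def)
    ultimately show "r * (norm v)\<^sup>2 \<le> v \<bullet> (S *v v)" "v \<bullet> (S *v v) \<le> r' * (norm v)\<^sup>2"
      using b[of e] by (auto simp: mult.commute[of "(norm v)\<^sup>2"] intro: mult_right_mono)
  qed
  show "v \<bullet> (matrix_inv S *v w) = (matrix_inv S *v v) \<bullet> w"
    using sym[of "matrix_inv S *v v" "matrix_inv S *v w"] inv by simp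
  let ?z = "matrix_inv S *v v"
  have zv: "?z \<bullet> (S *v ?z) = ?z \<bullet> v" by (simp add: inv)
  have "r * (norm ?z)\<^sup>2 \<le> norm ?z * norm v"
    using bb(1)[of ?z] norm_cauchy_schwarz[of ?z v] zv by simp
  then have "r * norm ?z \<le> norm v"
    by (cases "?z = 0") (auto simp: power2_eq_square)
  then show "norm ?z \<le> inverse r * norm v"
    using r by (simp add: field_simps)
  text \<open>Positivity of the form at \<open>?z - t v\<close>, with the optimal \<open>t = 1 / r'\<close>.\<close>
  let ?t = "inverse r'"
  have "0 \<le> (?z - ?t *\<^sub>R v) \<bullet> (S *v (?z - ?t *\<^sub>R v))"
    using bb(1)[of "?z - ?t *\<^sub>R v"] r by (meson order.trans mult_nonneg_nonneg less_imp_le zero_le_power2)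
  also have "\<dots> = v \<bullet> ?z - 2 * ?t * (v \<bullet> v) + ?t\<^sup>2 * (v \<bullet> (S *v v))"
    using sym[of ?z v] by (simp add: matrix_vector_mult_diff_distrib matrix_vector_mult_scaleR inv
        inner_diff_left inner_diff_right inner_commute power2_eq_square algebra_simps)
  also have "\<dots> \<le> v \<bullet> ?z - 2 * ?t * (v \<bullet> v) + ?t\<^sup>2 * (r' * (norm v)\<^sup>2)"
    by (intro add_left_mono mult_left_mono bb) auto
  also have "\<dots> = v \<bullet> ?z - ?t * (norm v)\<^sup>2"
    using r by (simp add: dot_square_norm power2_eq_square)
  finally show "inverse r' * (norm v)\<^sup>2 \<le> v \<bullet> ?z" by simp
qed

section \<open>Measurability of the inverse matrix\<close>

lemma lower_semicontinuous_open:
  assumes "lower_semicontinuous g" shows "open {z. a < g z}"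
proof (rule topological_space_class.openI)
  fix z assume "z \<in> {z. a < g z}"
  then have "\<forall>\<^sub>F w in nhds z. a < g w"
    using assms by (simp add: lower_semicontinuous_def)
  then obtain T where "open T" "z \<in> T" "\<forall>w\<in>T. a < g w" unfolding eventually_nhds by blast
  then show "\<exists>T. open T \<and> z \<in> T \<and> T \<subseteq> {z. a < g z}" by (intro exI[of _ T]) auto
qed

text \<open>Along the continuous curve of pairs \<open>(x, x - v)\<close> the transport cost is
  exactly this form, so its strict superlevel sets are open.\<close>

lemma quadratic_form_measurable:
  fixes A :: "real^'n \<Rightarrow> real^'n^'n"
  assumes "lower_semicontinuous (\<lambda>(x, x'). transport_cost A x x')"
  shows "(\<lambda>x. v \<bullet> (A x *v v)) \<in> borel_measurable borel"
  unfolding borel_measurable_iff_greater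
proof
  fix a
  have "{x \<in> space borel. a < v \<bullet> (A x *v v)}
      = (\<lambda>x. (x, x - v)) -` {z. a < (case z of (x, x') \<Rightarrow> transport_cost A x x')}"
    by (auto simp: transport_cost_def)
  also have "open \<dots>"
    by (intro open_vimage lower_semicontinuous_open assms continuous_intros)
  finally show "{x \<in> space borel. a < v \<bullet> (A x *v v)} \<in> sets borel" by (rule borel_open)
qed

text \<open>Polarisation at the coordinate vectors recovers the entries of \<open>A x\<close> from
  its quadratic form; Cramer's rule then writes the solution as quotients of determinants in these
  entries.\<close>

lemma matrix_inv_measurable:
  fixes A :: "real^'n \<Rightarrow> real^'n^'n"
  assumes A: "\<And>x. positive_definite (A x)"
    and qf: "\<And>v. (\<lambda>x. v \<bullet> (A x *v v)) \<in> borel_measurable borel"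
  shows "(\<lambda>x. matrix_inv (A x) *v b) \<in> borel_measurable borel"
proof -
  have sym: "v \<bullet> (A x *v w) = (A x *v v) \<bullet> w" for v w x
    using A[of x] transpose_eq_iff_selfadjoint by (auto simp: positive_definite_def)
  have "A x $ i $ j = ((axis i 1 + axis j 1) \<bullet> (A x *v (axis i 1 + axis j 1))
      - axis i 1 \<bullet> (A x *v axis i 1) - axis j 1 \<bullet> (A x *v axis j 1)) / 2" for x i j
  proof -
    have "axis i 1 \<bullet> (A x *v axis j 1) = A x $ i $ j"
      by (simp add: inner_axis' matrix_vector_mul_component inner_axis)
    moreover have "axis j 1 \<bullet> (A x *v axis i 1) = axis i 1 \<bullet> (A x *v axis j 1)"
      using sym[of "axis j 1" x "axis i 1"] by (simp add: inner_commute)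
    ultimately show ?thesis
      by (simp add: matrix_vector_right_distrib inner_add_left inner_add_right)
  qed
  then have entry: "(\<lambda>x. A x $ i $ j) \<in> borel_measurable borel" for i j
    by (simp only:) (intro borel_measurable_divide borel_measurable_diff qf borel_measurable_const)
  have det: "(\<lambda>x. det (S x)) \<in> borel_measurable borel"
    if "\<And>i j. (\<lambda>x. S x $ i $ j) \<in> borel_measurable borel" for S :: "real^'n \<Rightarrow> real^'n^'n"
    unfolding det_def using that
    by (intro borel_measurable_sum borel_measurable_times borel_measurable_const borel_measurable_prod)
  have dnz: "det (A x) \<noteq> 0" for x
    using positive_definite_invertible[OF A] invertible_det_nz by blast
  have "A x *v (matrix_inv (A x) *v b) = b" for x
    by (simp add: matrix_vector_mul_assoc matrix_inv_mult positive_definite_invertible A)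
  then have eq: "matrix_inv (A x) *v b = (\<chi> k. det (\<chi> i j. if j = k then b $ i else A x $ i $ j) / det (A x))" for x
    using cramer[OF dnz] by blast
  have comp: "(\<lambda>x. (matrix_inv (A x) *v b) $ k) \<in> borel_measurable borel" for k
  proof -
    have "(\<lambda>x. (\<chi> i j. if j = k then b $ i else A x $ i $ j) $ i $ j) \<in> borel_measurable borel" for i j
      using entry by (cases "j = k") auto
    then show ?thesis
      unfolding eq vec_lambda_beta by (intro borel_measurable_divide det entry) auto
  qed
  show ?thesis
    unfolding borel_measurable_euclidean_space[of "\<lambda>x. matrix_inv (A x) *v b"]
    using comp by (auto simp: Basis_vec_def inner_axis)
qed

lemma has_hessian_linear: "has_hessian f H z \<Longrightarrow> linear H"
  unfolding has_hessian_def by (auto dest: has_derivative_linear)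

lemma loewner_ge_scaled_identity:
  fixes H :: "real^'n \<Rightarrow> real^'n"
  assumes "linear H" "\<And>v w. v \<bullet> H w = H v \<bullet> w" "\<And>v. c * (norm v)\<^sup>2 \<le> v \<bullet> H v"
  shows "loewner_ge (matrix H) (c *\<^sub>R mat 1)"
proof -
  have *: "(matrix H - c *\<^sub>R mat 1) *v v = H v - c *\<^sub>R v" for v
  proof -
    have "matrix H *v v = H v" using matrix_works[of H] linear_matrix_vector_mul_eq[of H] assms(1) by simp
    then show ?thesis
      by (simp add: matrix_vector_mult_diff_rdistrib scaleR_matrix_vector_assoc[symmetric])
  qed
  show ?thesis
    unfolding loewner_ge_def positive_semidefinite_def transpose_eq_iff_selfadjoint *
    using assms by (simp add: inner_diff_left inner_diff_right dot_square_norm)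
qed

subsection \<open>Strong convexity\<close>

text \<open>Adding the tangent inequalities at two points shows that \<open>l1\<close> is
  monotone.\<close>

lemma convex_deriv2_nonneg:
  fixes l :: "real \<Rightarrow> real"
  assumes cvx: "convex_on UNIV l"
    and d: "\<And>u. (l has_real_derivative l1 u) (at u)"
    and d2: "(l1 has_real_derivative c) (at u)"
  shows "0 \<le> c"
proof (rule mono_on_imp_deriv_nonneg[OF _ d2])
  have tangent: "l1 a * (b - a) \<le> l b - l a" for a b
    using convex_on_imp_above_tangent[OF cvx, of a b] d by simp
  show "mono_on UNIV l1"
  proof (rule mono_onI)
    fix a b :: real assume "a \<le> b"
    moreover have "l1 a * (b - a) \<le> l1 b * (b - a)"
      using tangent[of a b] tangent[of b a] by (simp add: algebra_simps)
    ultimately show "l1 a \<le> l1 b" by (cases "a = b") auto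
  qed
qed simp

text \<open>The thresholds may depend on \<open>L\<close> but precede \<open>\<delta>\<close>.
  Boundedness takes two forms because \<open>lam \<ge> K1 L \<rho>max * norm \<beta>\<close> keeps
  \<open>lam\<close> away from 0 only where \<open>norm \<beta>\<close> is: this is uniform when
  \<open>0 \<notin> B\<close>, and holds for each \<open>\<epsilon>\<close> in general.\<close>

theorem theorem3:
  fixes P0 :: "(real^'n) measure"
    and A :: "real^'n \<Rightarrow> real^'n^'n"
    and l :: "real \<Rightarrow> real"
    and B :: "(real^'n) set"
    and \<rho>min \<rho>max M :: real
  assumes "prob_space P0" and "sets P0 = sets borel"
    and "\<And>x. positive_definite (A x)"
    and "B \<noteq> {}"
    and "lower_semicontinuous (\<lambda>(x, x'). transport_cost A x x')"
    and "0 < \<rho>min" and "0 < \<rho>max"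
    and "AE x in P0. \<forall>v. norm v = 1 \<longrightarrow> \<rho>min \<le> v \<bullet> (A x *v v) \<and> v \<bullet> (A x *v v) \<le> \<rho>max"
    and "convex_on UNIV l"
    and "growth_rate l < \<infinity>"
    and "integrable P0 (\<lambda>x. norm x ^ 4)"
    and "\<And>u. l differentiable (at u)" and "\<And>u. deriv l differentiable (at u)"
    and "0 < M" and "\<And>u. deriv (deriv l) u \<le> M"
    and "\<And>\<beta>. \<beta> \<in> B \<Longrightarrow> 0 < measure P0 {x \<in> space P0. deriv l (\<beta> \<bullet> x) \<noteq> 0}"
    and "convex B" and "compact B"
  shows "(\<exists>L U. deriv_second_moment_bounds P0 l B L U) \<and>
    (\<forall>L U. deriv_second_moment_bounds P0 l B L U \<longrightarrow>
      (\<exists>\<delta>0>0. \<exists>\<kappa>0>0. \<forall>\<delta>. 0 < \<delta> \<and> \<delta> < \<delta>0 \<longrightarrow>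
        (let f = dro_objective P0 A l \<delta>;
             V = V_region B (K1 L \<rho>max) (K2 \<delta> M (radius B) \<rho>min U)
         in (\<forall>z \<in> V - {(0, 0)}. twice_differentiable_at f z) \<and>
            (0 \<notin> B \<longrightarrow> (\<exists>C. \<forall>z \<in> V. onorm (hessian f z) \<le> C)) \<and>
            (\<forall>\<epsilon>>0. \<exists>C. \<forall>(\<beta>, lam) \<in> V. \<epsilon> \<le> norm \<beta> \<longrightarrow> onorm (hessian f (\<beta>, lam)) \<le> C) \<and>
            (\<forall>(\<beta>, lam) \<in> V - {(0, 0)}.
               loewner_ge (matrix (hessian (\<lambda>b. f (b, lam)) \<beta>))
                          ((sqrt \<delta> * \<kappa>0 * inverse lam) *\<^sub>R mat 1)))))"
proof -
  interpret P0: prob_space P0 by (rule assms(1))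
  note setsP = assms(2) and pd = assms(3) and rmin = assms(6) and rmax = assms(7) and M = assms(14)
  obtain N where N: "{x \<in> space P0. \<not> (\<forall>v. norm v = 1 \<longrightarrow> \<rho>min \<le> v \<bullet> (A x *v v) \<and> v \<bullet> (A x *v v) \<le> \<rho>max)} \<subseteq> N"
    "emeasure P0 N = 0" "N \<in> sets P0"
    using assms(8) by (rule AE_E)
  have space: "space P0 = UNIV" using sets_eq_imp_space_eq[OF setsP] by simp
  have good: "\<rho>min \<le> v \<bullet> (A x *v v) \<and> v \<bullet> (A x *v v) \<le> \<rho>max" if "x \<notin> N" "norm v = 1" for x v
    using N(1) that space by blast
  have AE_N: "AE x in P0. x \<notin> N"
    using N by (intro AE_not_in) (auto simp: null_sets_def)
  \<comment> \<open>Total mass 1 yields a point outside the null set, where the two bounds can be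
    compared.\<close>
  have rho_le: "\<rho>min \<le> \<rho>max"
  proof -
    have "N \<noteq> UNIV" using N(2) P0.emeasure_space_1 space by auto
    then obtain x where "x \<notin> N" by blast
    from good[OF this, of "axis undefined 1"] show ?thesis by simp
  qed
  \<comment> \<open>The substitute on \<open>N\<close> meets the lower bound with equality, and the
    upper one because \<open>\<rho>min \<le> \<rho>max\<close>.\<close>
  define Q where "Q = (\<lambda>x v. if x \<in> N then inverse \<rho>max *\<^sub>R v else matrix_inv (A x) *v v)"
  note inv = positive_definite_inverse_bounds[OF pd rmin rmax good]
  have l1: "(l has_real_derivative deriv l u) (at u)" for u
    using assms(12) by (simp add: DERIV_deriv_iff_real_differentiable)
  have l2: "(deriv l has_real_derivative deriv (deriv l) u) (at u)" for u
    using assms(13) by (simp add: DERIV_deriv_iff_real_differentiable)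
  have dual: "robust_dual P0 Q l (deriv l) (deriv (deriv l)) M (sqrt \<delta>) (inverse \<rho>max) (inverse \<rho>min)"
    if "0 < \<delta>" for \<delta>
  proof (rule robust_dual.intro)
    show "integrable P0 (\<lambda>x. (norm x)\<^sup>2)"
    proof (rule Bochner_Integration.integrable_bound)
      show "integrable P0 (\<lambda>x. 1 + norm x ^ 4)" using assms(11) by simp
      have "\<bar>n\<^sup>2\<bar> \<le> \<bar>1 + n ^ 4\<bar>" for n :: real
      proof -
        have "0 \<le> (1 - n\<^sup>2)\<^sup>2" "0 \<le> n\<^sup>2" by auto
        moreover have "(1 - n\<^sup>2)\<^sup>2 = 1 - 2 * n\<^sup>2 + n ^ 4"
          by (simp add: power2_eq_square power4_eq_xxxx algebra_simps)
        ultimately show ?thesis by linarith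
      qed
      then show "AE x in P0. norm ((norm x)\<^sup>2) \<le> norm (1 + norm x ^ 4)" by simp
      have "(\<lambda>x. (norm x)\<^sup>2) \<in> borel_measurable (borel :: (real^'n) measure)" by measurable
      then show "(\<lambda>x. (norm x)\<^sup>2) \<in> borel_measurable P0"
        using measurable_cong_sets[OF setsP refl] by blast
    qed
    show "bounded_linear (Q x)" for x
      unfolding Q_def by (cases "x \<in> N") (simp_all add: bounded_linear_scaleR_right)
    show "v \<bullet> Q x w = Q x v \<bullet> w" for x v w
      using inv(1)[of x v w] by (simp add: Q_def)
    show "inverse \<rho>max * (norm v)\<^sup>2 \<le> v \<bullet> Q x v" for x v
      using inv(2)[of x v] by (simp add: Q_def dot_square_norm)
    show "norm (Q x v) \<le> inverse \<rho>min * norm v" for x v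
      using inv(3)[of x v] rmin rmax rho_le by (auto simp: Q_def intro!: mult_right_mono le_imp_inverse_le)
    show "(\<lambda>x. Q x v) \<in> borel_measurable borel" for v
      unfolding Q_def using N(3) setsP
      by (intro measurable_If_set matrix_inv_measurable pd quadratic_form_measurable assms(5)) auto
    show "0 \<le> deriv (deriv l) u" for u
      by (rule convex_deriv2_nonneg[OF assms(9) l1 l2])
  qed (use assms that l1 l2 in auto)
  obtain R where R: "0 \<le> R" "\<And>b. b \<in> B \<Longrightarrow> norm b \<le> R"
    using compact_imp_bounded[OF assms(18)] assms(4)
    by (meson bounded_iff ex_in_conv norm_ge_zero order.trans)
  \<comment> \<open>The moment bounds do not involve \<open>\<delta>\<close>; the value 1 merely
    instantiates the locale.\<close>
  interpret one: robust_dual P0 Q l "deriv l" "deriv (deriv l)" M "sqrt 1" "inverse \<rho>max" "inverse \<rho>min"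
    by (rule dual) simp
  obtain L U where "0 < L" "0 < U"
    "\<And>b. b \<in> B \<Longrightarrow> L \<le> (\<integral>x. (deriv l (b \<bullet> x))\<^sup>2 \<partial>P0)"
    "\<And>b. b \<in> B \<Longrightarrow> (\<integral>x. (deriv l (b \<bullet> x))\<^sup>2 \<partial>P0) \<le> U"
    using one.l1_square_moment_bounds[OF assms(18,4,16)] by blast
  then have "deriv_second_moment_bounds P0 l B L U"
    unfolding deriv_second_moment_bounds_def using one.l1_square_integrable by blast
  moreover have "\<exists>\<delta>0>0. \<exists>\<kappa>0>0. \<forall>\<delta>. 0 < \<delta> \<and> \<delta> < \<delta>0 \<longrightarrow>
        (let f = dro_objective P0 A l \<delta>;
             V = V_region B (K1 L \<rho>max) (K2 \<delta> M (radius B) \<rho>min U)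
         in (\<forall>z \<in> V - {(0, 0)}. twice_differentiable_at f z) \<and>
            (0 \<notin> B \<longrightarrow> (\<exists>C. \<forall>z \<in> V. onorm (hessian f z) \<le> C)) \<and>
            (\<forall>\<epsilon>>0. \<exists>C. \<forall>(\<beta>, lam) \<in> V. \<epsilon> \<le> norm \<beta> \<longrightarrow> onorm (hessian f (\<beta>, lam)) \<le> C) \<and>
            (\<forall>(\<beta>, lam) \<in> V - {(0, 0)}.
               loewner_ge (matrix (hessian (\<lambda>b. f (b, lam)) \<beta>))
                          ((sqrt \<delta> * \<kappa>0 * inverse lam) *\<^sub>R mat 1)))"
    if LU: "deriv_second_moment_bounds P0 l B L U" for L U
  proof -
    have L: "0 < L" and Lb: "\<And>b. b \<in> B \<Longrightarrow> L \<le> (\<integral>x. (deriv l (b \<bullet> x))\<^sup>2 \<partial>P0)"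
      using LU by (auto simp: deriv_second_moment_bounds_def)
    define k1 where "k1 = K1 L \<rho>max"
    have k1: "0 < k1" unfolding k1_def K1_def using L rmax by simp
    \<comment> \<open>Membership in \<open>dom\<close> follows from
      \<open>sqrt \<delta> * M * inverse \<rho>min * norm b < k1\<close>, after multiplication by
      \<open>norm b\<close>. Using \<open>R + 1\<close> keeps the denominator positive even when
      \<open>R = 0\<close>.\<close>
    define s0 where "s0 = k1 * \<rho>min / (M * (R + 1))"
    have s0: "0 < s0" unfolding s0_def using k1 rmin M R by simp
    \<comment> \<open>The constant of \<open>Hess_fst_lower\<close> for
      \<open>cl = inverse \<rho>max\<close>, with \<open>sqrt \<delta>\<close> and
      \<open>inverse t\<close> split off.\<close>
    define \<kappa>0 where "\<kappa>0 = L / (2 * \<rho>max)"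
    have \<kappa>0: "0 < \<kappa>0" unfolding \<kappa>0_def using L rmax by simp
    show ?thesis
    proof (rule exI[of _ "s0\<^sup>2"], rule conjI, rule zero_less_power[OF s0],
        rule exI[of _ \<kappa>0], rule conjI, rule \<kappa>0, intro allI impI)
      fix \<delta> assume \<delta>: "0 < \<delta> \<and> \<delta> < s0\<^sup>2"
      interpret rd: robust_dual P0 Q l "deriv l" "deriv (deriv l)" M "sqrt \<delta>" "inverse \<rho>max" "inverse \<rho>min"
        by (rule dual) (use \<delta> in simp)
      define f where "f = dro_objective P0 A l \<delta>"
      define k2 where "k2 = K2 \<delta> M (radius B) \<rho>min U"
      define V where "V = V_region B k1 k2"
      have "sqrt \<delta> < s0" using \<delta> s0 by (intro real_less_lsqrt) auto
      then have sd: "sqrt \<delta> * (M * (R + 1)) < k1 * \<rho>min"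
        unfolding s0_def using M R by (simp add: pos_less_divide_eq)
      \<comment> \<open>Off \<open>N\<close> the form \<open>rd.q\<close> is the one in the original
        objective, so the two integrands agree almost surely.\<close>
      have f_dom: "f p = ereal (rd.dual_integral p)" if p: "p \<in> rd.dom" for p
      proof -
        have "AE x in P0. robust_loss A l \<delta> (fst p) (snd p) x = ereal (rd.dual_value p x)"
          using AE_N
        proof eventually_elim
          case (elim x)
          have "rd.q p x = fst p \<bullet> (matrix_inv (A x) *v fst p)"
            unfolding rd.q_def using elim by (simp add: Q_def)
          then have "robust_loss A l \<delta> (fst p) (snd p) x
              = (SUP g. ereal (l (rd.shifted p x g) - snd p * sqrt \<delta> * (g\<^sup>2 * rd.q p x - 1)))"
            by (simp add: robust_loss_def dual_objective_def rd.shifted_def)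
          then show ?case by (simp add: rd.SUP_dual_value[OF p])
        qed
        from ext_expectation_integrable[OF rd.integrals(1)[OF p] this] show ?thesis
          by (simp add: f_def dro_objective_def rd.dual_integral_def case_prod_beta)
      qed
      have V: "b \<in> B \<and> k1 * norm b \<le> t \<and> t \<le> k2 * norm b \<and> norm b \<le> R" if "(b, t) \<in> V" for b t
        using that R by (auto simp: V_def V_region_def)
      have V_dom: "(b, t) \<in> rd.dom" if v: "(b, t) \<in> V" and "b \<noteq> 0" for b t
      proof -
        have b: "0 < norm b" using that by simp
        have "sqrt \<delta> * M * norm b \<le> sqrt \<delta> * (M * (R + 1))"
          using V[OF v] \<delta> M by (simp add: mult.assoc mult_left_mono)
        then have "sqrt \<delta> * M * inverse \<rho>min * norm b < k1"
          using sd rmin by (simp add: field_simps)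
        then have "sqrt \<delta> * M * inverse \<rho>min * norm b * norm b < k1 * norm b"
          using b by (rule mult_strict_right_mono)
        also have "\<dots> \<le> t" using V[OF v] by simp
        finally show ?thesis by (simp add: rd.dom_def power2_eq_square mult.assoc)
      qed
      \<comment> \<open>If the first component is 0, the constraints
        \<open>0 \<le> lam \<le> k2 * 0\<close> leave only the apex.\<close>
      have V_nz: "fst z \<noteq> 0" if "z \<in> V - {(0, 0)}" for z
        using that by (auto simp: V_def V_region_def)
      have hess: "has_hessian f (rd.Hess (b, t)) (b, t)" if "(b, t) \<in> V" "b \<noteq> 0" for b t
        by (rule rd.has_hessian_dual_integral[OF V_dom[OF that] f_dom])
      have a: "twice_differentiable_at f z" if "z \<in> V - {(0, 0)}" for z
        using hess[of "fst z" "snd z"] V_nz[OF that] that unfolding twice_differentiable_at_def by auto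
      have b: "\<exists>C. \<forall>(\<beta>, lam) \<in> V. \<epsilon> \<le> norm \<beta> \<longrightarrow> onorm (hessian f (\<beta>, lam)) \<le> C" if \<epsilon>: "\<epsilon> > 0" for \<epsilon>
      proof -
        \<comment> \<open>\<open>k1 * \<epsilon>\<close> bounds the multiplier from below, and
          \<open>R + \<bar>k2\<bar> * R\<close> bounds the norm of the pair; the absolute value
          avoids a discussion of the sign of \<open>k2\<close>.\<close>
        have "0 < k1 * \<epsilon>" "0 \<le> R + \<bar>k2\<bar> * R" using k1 \<epsilon> R by auto
        then obtain C where C: "\<And>p. p \<in> rd.reg (k1 * \<epsilon>) (R + \<bar>k2\<bar> * R) \<Longrightarrow> onorm (rd.Hess p) \<le> C"
          using rd.onorm_Hess_bound by blast
        have "onorm (hessian f (b, t)) \<le> C" if v: "(b, t) \<in> V" and e: "\<epsilon> \<le> norm b" for b t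
        proof -
          have nz: "b \<noteq> 0" using e \<epsilon> by auto
          have t: "k1 * \<epsilon> \<le> t" using V[OF v] mult_left_mono[OF e, of k1] k1 by linarith
          have "t \<le> \<bar>k2\<bar> * R"
            using V[OF v] mult_mono[OF abs_ge_self[of k2], of "norm b" R] by auto
          moreover have "norm (b, t) \<le> norm b + norm t" by (rule norm_Pair_le)
          moreover have "0 < t" using t k1 \<epsilon> mult_pos_pos[of k1 \<epsilon>] by linarith
          ultimately have "norm (b, t) \<le> R + \<bar>k2\<bar> * R" using V[OF v] by simp
          then have "(b, t) \<in> rd.reg (k1 * \<epsilon>) (R + \<bar>k2\<bar> * R)"
            using V_dom[OF v nz] t by (simp add: rd.reg_def)
          then show ?thesis using C hessian_eqI[OF hess[OF v nz]] by simp
        qed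
        then show ?thesis by blast
      qed
      \<comment> \<open>The least norm on the compact set \<open>B\<close> is then positive and
        serves as \<open>\<epsilon>\<close>.\<close>
      have c: "\<exists>C. \<forall>z \<in> V. onorm (hessian f z) \<le> C" if "0 \<notin> B"
      proof -
        obtain b0 where b0: "b0 \<in> B" "\<And>b. b \<in> B \<Longrightarrow> norm b0 \<le> norm b"
          using continuous_attains_inf[OF assms(18,4) continuous_on_norm[OF continuous_on_id]] by auto
        have "0 < norm b0" using b0 that by auto
        from b[OF this] b0(2) V show ?thesis by (metis (no_types, lifting) case_prodD surj_pair)
      qed
      have d: "loewner_ge (matrix (hessian (\<lambda>b. f (b, t)) b)) ((sqrt \<delta> * \<kappa>0 * inverse t) *\<^sub>R mat 1)"
        if "(b, t) \<in> V - {(0, 0)}" for b t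
      proof -
        have v: "(b, t) \<in> V" and nz: "b \<noteq> 0" using that V_nz[OF that] by auto
        note p = V_dom[OF v nz]
        have h: "has_hessian (\<lambda>b. f (b, t)) (\<lambda>h. fst (rd.Hess (b, t) (h, 0))) b"
          by (rule has_hessian_fst[OF hess[OF v nz]])
        have low: "sqrt \<delta> * inverse \<rho>max * L / (2 * t) * (norm w)\<^sup>2 \<le> w \<bullet> fst (rd.Hess (b, t) (w, 0))" for w
          using rd.Hess_fst_lower[OF p, of L w] rd.l1_square_integrable[of b] Lb V[OF v] by simp
        show ?thesis
          unfolding hessian_eqI[OF h]
        proof (rule loewner_ge_scaled_identity[OF has_hessian_linear[OF h]])
          show "v \<bullet> fst (rd.Hess (b, t) (w, 0)) = fst (rd.Hess (b, t) (v, 0)) \<bullet> w" for v w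
            by (rule rd.Hess_fst_sym[OF p])
          show "sqrt \<delta> * \<kappa>0 * inverse t * (norm w)\<^sup>2 \<le> w \<bullet> fst (rd.Hess (b, t) (w, 0))" for w
            using low[of w] by (simp add: \<kappa>0_def field_simps)
        qed
      qed
      show "let f = dro_objective P0 A l \<delta>;
             V = V_region B (K1 L \<rho>max) (K2 \<delta> M (radius B) \<rho>min U)
         in (\<forall>z \<in> V - {(0, 0)}. twice_differentiable_at f z) \<and>
            (0 \<notin> B \<longrightarrow> (\<exists>C. \<forall>z \<in> V. onorm (hessian f z) \<le> C)) \<and>
            (\<forall>\<epsilon>>0. \<exists>C. \<forall>(\<beta>, lam) \<in> V. \<epsilon> \<le> norm \<beta> \<longrightarrow> onorm (hessian f (\<beta>, lam)) \<le> C) \<and>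
            (\<forall>(\<beta>, lam) \<in> V - {(0, 0)}.
               loewner_ge (matrix (hessian (\<lambda>b. f (b, lam)) \<beta>))
                          ((sqrt \<delta> * \<kappa>0 * inverse lam) *\<^sub>R mat 1))"
        unfolding Let_def k1_def[symmetric] k2_def[symmetric] V_def[symmetric] f_def[symmetric]
      proof (intro conjI ballI impI allI)
        fix z assume "z \<in> V - {(0, 0)}"
        then show "case z of (b, t) \<Rightarrow> loewner_ge (matrix (hessian (\<lambda>b. f (b, t)) b))
            ((sqrt \<delta> * \<kappa>0 * inverse t) *\<^sub>R mat 1)"
          using d[of "fst z" "snd z"] by (simp add: case_prod_beta)
      qed (use a b c in blast)+
    qed
  qed
  ultimately show ?thesis by blast
qed

end
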